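(* Let $K\in End_{\mathcal{A}}^{\ast}(H)$, $C,C'\in GL^{+}(H)$, and let $\{W_j,\Lambda_j,v_j\}_{j\in J}$ be a $(C,C')$-controlled $K$-$g$-fusion frame for $H$ with frame bounds $A,B$. Let $\Gamma_j\in End_{\mathcal{A}}^{\ast}(H,H_j)$ for $j\in J$, let $\{V_j\}_{j\in J}$ be orthogonally complemented closed submodules of $H$ and $\{u_j\}_{j\in J}$ a family of weights in $\mathcal{A}$. Assume that $C$ and $C'$ commute with each other and with $P_{W_j}\Lambda_j^{\ast}\Lambda_jP_{W_j}$ and $P_{V_j}\Gamma_j^{\ast}\Gamma_jP_{V_j}$ for each $j\in J$. Suppose that for each $f\in H$, $$\big\|\big((v_j\Lambda_jP_{W_j}-u_j\Gamma_jP_{V_j})(CC')^{\frac12}f\big)_{j\in J}\big\|\le\lambda_1\big\|\big(v_j\Lambda_jP_{W_j}(CC')^{\frac12}f\big)_{j\in J}\big\|+\lambda_2\big\|\big(u_j\Gamma_jP_{V_j}(CC')^{\frac12}f\big)_{j\in J}\big\|+\epsilon\|K^{\ast}f\|,$$ where $0<\lambda_1,\lambda_2<1$ and $\epsilon>0$ is such that $\epsilon<(1-\lambda_1)\sqrt{A}$. Then $\{V_j,\Gamma_j,u_j\}_{j\in J}$ is a $(C,C')$-controlled $K$-$g$-fusion frame for $H$.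
   Context: $\mathcal{A}$ is a unital $C^{\ast}$-algebra, $J$ is a countable index set, $H$ and $L$ are countably generated Hilbert $\mathcal{A}$-modules (left modules, with inner product $\mathcal{A}$-linear in the first variable), and $\{H_j\}_{j\in J}$ is a sequence of submodules of $L$. $\|f\|=\|\langle f,f\rangle\|^{1/2}$. $End_{\mathcal{A}}^{\ast}(H,H_j)$ is the set of adjointable $\mathcal{A}$-linear maps $H\to H_j$, and $End_{\mathcal{A}}^{\ast}(H)=End_{\mathcal{A}}^{\ast}(H,H)$. $GL^{+}(H)$ is the set of all positive bounded linear invertible operators on $H$ with bounded inverse. A family of weights is a family of positive invertible elements of the center of $\mathcal{A}$. $P_{W}$ is the orthogonal projection of $H$ onto an orthogonally complemented closed submodule $W$. $\{W_j,\Lambda_j,v_j\}_{j\in J}$ (with $W_j$ orthogonally complemented closed submodules of $H$, $v_j$ weights, $\Lambda_j\in End_{\mathcal{A}}^{\ast}(H,H_j)$) is a $(C,C')$-controlled $K$-$g$-fusion frame for $H$ with bounds $A,B$ ($0<A\le B<\infty$) if $A\langle K^{\ast}f,K^{\ast}f\rangle\le\sum_{j\in J}v_j^2\langle\Lambda_jP_{W_j}Cf,\Lambda_jP_{W_j}C'f\rangle\le B\langle f,f\rangle$ for all $f\in H$. The norms of sequences are those of the Hilbert $\mathcal{A}$-module $l^{2}(\{H_j\}_{j\in J})=\{\{f_j\}_{j\in J}: f_j\in H_j,\ \|\sum_{j\in J}\langle f_j,f_j\rangle\|<\infty\}$, i.e. $\|(f_j)_{j\in J}\|=\|\sum_{j\in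 J}\langle f_j,f_j\rangle\|^{1/2}$. *)

theory Defs
  imports "HOL-Analysis.Analysis"
begin

text \<open>Unital \<open>C\<^sup>*\<close>-algebras over the complex numbers.  The superclass forces \<open>0 \<noteq> 1\<close>, so only the
  zero algebra is excluded; over it every module is zero.\<close>

class cstar_algebra = real_normed_algebra_1 + banach +
  fixes scaleC :: "complex \<Rightarrow> 'a \<Rightarrow> 'a" (infixr \<open>*\<^sub>C\<close> 75)
    and star :: "'a \<Rightarrow> 'a"
  assumes scaleC_add_right: "c *\<^sub>C (a + b) = c *\<^sub>C a + c *\<^sub>C b"
    and scaleC_add_left: "(c + d) *\<^sub>C a = c *\<^sub>C a + d *\<^sub>C a"
    and scaleC_scaleC: "c *\<^sub>C d *\<^sub>C a = (c * d) *\<^sub>C a"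
    and scaleC_of_real: "complex_of_real r *\<^sub>C a = r *\<^sub>R a"
    and mult_scaleC_left: "(c *\<^sub>C a) * b = c *\<^sub>C (a * b)"
    and mult_scaleC_right: "a * (c *\<^sub>C b) = c *\<^sub>C (a * b)"
    and norm_scaleC: "norm (c *\<^sub>C a) = cmod c * norm a"
    and star_add: "star (a + b) = star a + star b"
    and star_scaleC: "star (c *\<^sub>C a) = cnj c *\<^sub>C star a"
    and star_mult: "star (a * b) = star b * star a"
    and star_star: "star (star a) = a"
    and cstar_identity: "norm (star a * a) = (norm a)\<^sup>2"

definition alg_invertible :: "'a::monoid_mult \<Rightarrow> bool" where
  "alg_invertible a \<longleftrightarrow> (\<exists>b. a * b = 1 \<and> b * a = 1)"

definition alg_spectrum :: "'a::cstar_algebra \<Rightarrow> complex set" where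
  "alg_spectrum a = {c. \<not> alg_invertible (a - c *\<^sub>C 1)}"

definition cstar_pos :: "'a::cstar_algebra \<Rightarrow> bool" where
  "cstar_pos a \<longleftrightarrow> star a = a \<and> alg_spectrum a \<subseteq> {complex_of_real r | r. r \<ge> 0}"

definition cstar_le :: "'a::cstar_algebra \<Rightarrow> 'a \<Rightarrow> bool" (infix \<open>\<sqsubseteq>\<close> 50) where
  "a \<sqsubseteq> b \<longleftrightarrow> cstar_pos (b - a)"

definition weight :: "'a::cstar_algebra \<Rightarrow> bool" where
  "weight v \<longleftrightarrow> cstar_pos v \<and> alg_invertible v \<and> (\<forall>a. v * a = a * v)"

text \<open>Left modules with an algebra-valued inner product, linear in the first variable.  The
  underlying type carries the Banach space structure; \<open>act_scaleR\<close> and \<open>norm_eq\<close> below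
  tie it to the module structure.  The complex scalars act through \<open>c *\<^sub>C 1\<close>.\<close>

record ('a, 'h) hmod =
  act :: "'a \<Rightarrow> 'h \<Rightarrow> 'h"
  ip :: "'h \<Rightarrow> 'h \<Rightarrow> 'a"

locale hilbert_module =
  fixes H :: "('a::cstar_algebra, 'h::banach) hmod"
  assumes act_add_left: "act H (a + b) x = act H a x + act H b x"
    and act_add_right: "act H a (x + y) = act H a x + act H a y"
    and act_act: "act H a (act H b x) = act H (a * b) x"
    and act_one: "act H 1 x = x"
    and act_scaleR: "act H (r *\<^sub>R 1) x = r *\<^sub>R x"
    and ip_add_left: "ip H (x + y) z = ip H x z + ip H y z"
    and ip_act_left: "ip H (act H a x) y = a * ip H x y"
    and ip_star: "star (ip H x y) = ip H y x"
    and ip_pos: "cstar_pos (ip H x x)"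
    and ip_eq_0: "ip H x x = 0 \<longleftrightarrow> x = 0"
    and norm_eq: "norm x = sqrt (norm (ip H x x))"

definition submodule :: "('a::cstar_algebra, 'h::banach) hmod \<Rightarrow> 'h set \<Rightarrow> bool" where
  "submodule H W \<longleftrightarrow> 0 \<in> W \<and> (\<forall>x\<in>W. \<forall>y\<in>W. x + y \<in> W) \<and> (\<forall>a. \<forall>x\<in>W. act H a x \<in> W)"

definition countably_generated :: "('a::cstar_algebra, 'h::banach) hmod \<Rightarrow> bool" where
  "countably_generated H \<longleftrightarrow> (\<exists>S. countable S \<and> closure (submodule H hull S) = UNIV)"

definition orth_compl :: "('a::cstar_algebra, 'h::banach) hmod \<Rightarrow> 'h set \<Rightarrow> 'h set" where
  "orth_compl H W = {x. \<forall>w\<in>W. ip H x w = 0}"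

definition complemented_submodule :: "('a::cstar_algebra, 'h::banach) hmod \<Rightarrow> 'h set \<Rightarrow> bool" where
  "complemented_submodule H W \<longleftrightarrow> submodule H W \<and> closed W \<and>
     (\<forall>x. \<exists>w\<in>W. \<exists>z\<in>orth_compl H W. x = w + z)"

definition proj :: "('a::cstar_algebra, 'h::banach) hmod \<Rightarrow> 'h set \<Rightarrow> 'h \<Rightarrow> 'h" where
  "proj H W x = (THE w. w \<in> W \<and> x - w \<in> orth_compl H W)"

definition module_linear ::
  "('a::cstar_algebra, 'h::banach) hmod \<Rightarrow> ('a, 'l::banach) hmod \<Rightarrow> ('h \<Rightarrow> 'l) \<Rightarrow> bool" where
  "module_linear H L T \<longleftrightarrow>
     (\<forall>x y. T (x + y) = T x + T y) \<and> (\<forall>a x. T (act H a x) = act L a (T x))"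

text \<open>\<open>End\<^sup>*(H, S)\<close> for a submodule \<open>S\<close> of \<open>L\<close>: the adjoint is only required on \<open>S\<close>.\<close>

definition adjointable ::
  "('a::cstar_algebra, 'h::banach) hmod \<Rightarrow> ('a, 'l::banach) hmod \<Rightarrow> 'l set \<Rightarrow> ('h \<Rightarrow> 'l) set" where
  "adjointable H L S = {T. range T \<subseteq> S \<and> module_linear H L T \<and>
     (\<exists>T'. \<forall>x. \<forall>y\<in>S. ip L (T x) y = ip H x (T' y))}"

text \<open>The value of the adjoint of \<open>T\<close> at \<open>y\<close>; meaningful for \<open>T \<in> adjointable H L S\<close> and \<open>y \<in> S\<close>.\<close>

definition adj ::
  "('a::cstar_algebra, 'h::banach) hmod \<Rightarrow> ('a, 'l::banach) hmod \<Rightarrow> ('h \<Rightarrow> 'l) \<Rightarrow> 'l \<Rightarrow> 'h" where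
  "adj H L T y = (THE z. \<forall>x. ip L (T x) y = ip H x z)"

definition pos_op :: "('a::cstar_algebra, 'h::banach) hmod \<Rightarrow> ('h \<Rightarrow> 'h) \<Rightarrow> bool" where
  "pos_op H T \<longleftrightarrow> bounded_linear T \<and> module_linear H H T \<and> (\<forall>x. cstar_pos (ip H (T x) x))"

definition GL_pos :: "('a::cstar_algebra, 'h::banach) hmod \<Rightarrow> ('h \<Rightarrow> 'h) set" where
  "GL_pos H = {T. pos_op H T \<and> (\<exists>R. bounded_linear R \<and> T \<circ> R = id \<and> R \<circ> T = id)}"

definition op_sqrt :: "('a::cstar_algebra, 'h::banach) hmod \<Rightarrow> ('h \<Rightarrow> 'h) \<Rightarrow> 'h \<Rightarrow> 'h" where
  "op_sqrt H T = (THE R. pos_op H R \<and> R \<circ> R = T)"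

text \<open>Sums over the index set are unconditional norm limits.  For the positive terms below this
  agrees with norm convergence along any one enumeration.\<close>

definition l2_space ::
  "('a::cstar_algebra, 'l::banach) hmod \<Rightarrow> 'j set \<Rightarrow> ('j \<Rightarrow> 'l set) \<Rightarrow> ('j \<Rightarrow> 'l) set" where
  "l2_space L J Hs = {x. (\<forall>j\<in>J. x j \<in> Hs j) \<and> (\<lambda>j. ip L (x j) (x j)) summable_on J}"

definition l2_norm :: "('a::cstar_algebra, 'l::banach) hmod \<Rightarrow> 'j set \<Rightarrow> ('j \<Rightarrow> 'l) \<Rightarrow> real" where
  "l2_norm L J x = sqrt (norm (\<Sum>\<^sub>\<infinity>j\<in>J. ip L (x j) (x j)))"

definition controlled_frame_bounds ::
  "('a::cstar_algebra, 'h::banach) hmod \<Rightarrow> ('a, 'l::banach) hmod \<Rightarrow> 'j set \<Rightarrow> ('j \<Rightarrow> 'l set) \<Rightarrow>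
   ('h \<Rightarrow> 'h) \<Rightarrow> ('h \<Rightarrow> 'h) \<Rightarrow> ('h \<Rightarrow> 'h) \<Rightarrow>
   ('j \<Rightarrow> 'h set) \<Rightarrow> ('j \<Rightarrow> 'h \<Rightarrow> 'l) \<Rightarrow> ('j \<Rightarrow> 'a) \<Rightarrow> real \<Rightarrow> real \<Rightarrow> bool" where
  "controlled_frame_bounds H L J Hs C C' K W \<Lambda> v A B \<longleftrightarrow>
     0 < A \<and> A \<le> B \<and>
     (\<forall>j\<in>J. complemented_submodule H (W j) \<and> weight (v j) \<and> \<Lambda> j \<in> adjointable H L (Hs j)) \<and>
     (\<forall>f. let t = (\<lambda>j. (v j)\<^sup>2 *
                 ip L (\<Lambda> j (proj H (W j) (C f))) (\<Lambda> j (proj H (W j) (C' f))))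
          in t summable_on J \<and>
             A *\<^sub>R ip H (adj H H K f) (adj H H K f) \<sqsubseteq> (\<Sum>\<^sub>\<infinity>j\<in>J. t j) \<and>
             (\<Sum>\<^sub>\<infinity>j\<in>J. t j) \<sqsubseteq> B *\<^sub>R ip H f f)"

definition controlled_K_g_fusion_frame ::
  "('a::cstar_algebra, 'h::banach) hmod \<Rightarrow> ('a, 'l::banach) hmod \<Rightarrow> 'j set \<Rightarrow> ('j \<Rightarrow> 'l set) \<Rightarrow>
   ('h \<Rightarrow> 'h) \<Rightarrow> ('h \<Rightarrow> 'h) \<Rightarrow> ('h \<Rightarrow> 'h) \<Rightarrow>
   ('j \<Rightarrow> 'h set) \<Rightarrow> ('j \<Rightarrow> 'h \<Rightarrow> 'l) \<Rightarrow> ('j \<Rightarrow> 'a) \<Rightarrow> bool" where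
  "controlled_K_g_fusion_frame H L J Hs C C' K W \<Lambda> v \<longleftrightarrow>
     (\<exists>A B. controlled_frame_bounds H L J Hs C C' K W \<Lambda> v A B)"

text \<open>\<open>P\<^sub>W T\<^sup>* T P\<^sub>W\<close>\<close>

definition sandwich ::
  "('a::cstar_algebra, 'h::banach) hmod \<Rightarrow> ('a, 'l::banach) hmod \<Rightarrow> 'h set \<Rightarrow> ('h \<Rightarrow> 'l) \<Rightarrow> 'h \<Rightarrow> 'h" where
  "sandwich H L W T = proj H W \<circ> adj H L T \<circ> T \<circ> proj H W"

end

theory Submission
  imports Defs
begin

text \<open>
  Let \<open>R = (C C')\<^sup>1\<^sup>/\<^sup>2\<close>, let \<open>S\<close> be one of the operators \<open>P\<^sub>W T\<^sup>* T P\<^sub>W\<close> and \<open>v\<close> a weight.  Since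
  \<open>C\<close> and \<open>C'\<close> commute with \<open>S\<close>, so does \<open>R\<close>, and
  \<open>v\<^sup>2 \<langle>T P\<^sub>W C f, T P\<^sub>W C' f\<rangle> = v\<^sup>2 \<langle>f, S R\<^sup>2 f\<rangle> = \<langle>v T P\<^sub>W R f, v T P\<^sub>W R f\<rangle>\<close>
  (\<open>controlled_summand\<close>).  So the controlled sum of each family is the \<open>\<A>\<close>-valued square
  \<open>X f\<close> or \<open>Y f\<close> of the sequence \<open>x f\<close> or \<open>y f\<close> that occurs in the perturbation hypothesis.
  With the triangle inequality of \<open>l\<^sup>2\<close>, that hypothesis and the given frame bounds yield
  \<open>m \<parallel>K\<^sup>* f\<parallel> \<le> \<parallel>y f\<parallel> \<le> M \<parallel>f\<parallel>\<close> with \<open>m > 0\<close>, the smallness of \<open>\<epsilon>\<close> being what makes \<open>m\<close> positive.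

  These are inequalities between norms, whereas a frame asks for inequalities in \<open>\<A>\<close>.  The passage
  is \<open>norm_pos_diff_if_conj_norms\<close>: all three maps \<open>f \<mapsto> \<langle>K\<^sup>*f, K\<^sup>*f\<rangle>\<close>, \<open>Y\<close> and \<open>f \<mapsto> \<langle>f, f\<rangle>\<close>
  turn \<open>f \<mapsto> a f\<close> into conjugation by \<open>a\<close>, so the norm inequalities hold for all conjugates at once, and
  a conjugation that almost normalises the larger side to 1 gives the order inequality.

  Both steps rest on \<open>C\<^sup>*\<close>-algebra theory developed here.  The tool throughout is the binomial
  series of \<open>\<surd>(1 - X)\<close> for a contraction \<open>X\<close> of a Banach space, which serves elements of \<open>\<A>\<close>
  (acting by multiplication) as well as operators on \<open>H\<close>.  In \<open>\<A>\<close>, positivity is first studied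
  through the predicate \<open>norm_pos\<close>, which mentions norms only and makes the positive elements a
  closed convex cone; \<open>cstar_pos_iff_norm_pos\<close> identifies it with the spectral definition, and
  \<open>norm_pos_star_mult\<close> is the theorem that \<open>a\<^sup>*a \<ge> 0\<close>.  On \<open>H\<close>, the series gives existence of
  positive square roots, hence positivity of \<open>C C'\<close>, and uniqueness justifies \<open>op_sqrt\<close>.
\<close>

section \<open>The square root of \<open>1 - X\<close> for a contraction \<open>X\<close>\<close>

text \<open>The Taylor coefficients of \<open>\<surd>(1 - z)\<close>.\<close>

definition sqrt_coeff :: "nat \<Rightarrow> real" where
  "sqrt_coeff n = (-1) ^ n * ((1/2) gchoose n)"

lemma sqrt_coeff_0 [simp]: "sqrt_coeff 0 = 1"
  by (simp add: sqrt_coeff_def)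

lemma sqrt_coeff_convolution:
  "(\<Sum>i\<le>k. sqrt_coeff i * sqrt_coeff (k - i)) = (if k = 0 then 1 else if k = 1 then -1 else 0)"
proof -
  have "(\<Sum>i\<le>k. sqrt_coeff i * sqrt_coeff (k - i)) =
      (\<Sum>i\<in>{0..k}. (-1) ^ k * (((1/2::real) gchoose i) * ((1/2) gchoose (k - i))))"
  proof (rule sum.cong)
    fix i assume "i \<in> {0..k}"
    then have "(-1::real) ^ k = (-1) ^ i * (-1) ^ (k - i)"
      by (simp flip: power_add)
    then show "sqrt_coeff i * sqrt_coeff (k - i) =
        (-1) ^ k * (((1/2::real) gchoose i) * ((1/2) gchoose (k - i)))"
      by (simp add: sqrt_coeff_def)
  qed auto
  also have "\<dots> = (-1) ^ k * (of_nat (1 choose k))"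
    by (simp add: sum_distrib_left [symmetric] gbinomial_Vandermonde binomial_gbinomial)
  also have "\<dots> = (if k = 0 then 1 else if k = 1 then -1 else 0)"
    by (cases k; cases "k - 1") auto
  finally show ?thesis .
qed

lemma sqrt_coeff_Suc: "sqrt_coeff (Suc n) * real (Suc n) = sqrt_coeff n * (real n - 1/2)"
  using arg_cong [OF gbinomial_mult_1 [of "1/2::real" n], of "\<lambda>t. (-1) ^ n * t"]
  by (simp add: sqrt_coeff_def algebra_simps)

lemma sqrt_coeff_Suc_nonpos: "sqrt_coeff (Suc n) \<le> 0"
proof (induction n)
  case 0
  show ?case by (simp add: sqrt_coeff_def)
next
  case (Suc n)
  have "sqrt_coeff (Suc (Suc n)) * real (Suc (Suc n)) \<le> 0"
    unfolding sqrt_coeff_Suc [of "Suc n"] by (rule mult_nonpos_nonneg [OF Suc]) simp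
  then show ?case by (metis mult_le_0_iff of_nat_0_less_iff not_less zero_less_Suc)
qed

lemma sum_sqrt_coeff_nonneg: "0 \<le> (\<Sum>i\<le>n. sqrt_coeff i)"
proof -
  have "0 \<le> (-1) ^ n * ((-1/2::real) gchoose n)"
  proof (induction n)
    case (Suc n)
    have "((-1) ^ Suc n * ((-1/2::real) gchoose Suc n)) * real (Suc n) =
        ((-1) ^ n * ((-1/2::real) gchoose n)) * (real n + 1/2)"
      using arg_cong [OF gbinomial_mult_1 [of "-1/2::real" n], of "\<lambda>t. (-1) ^ n * t"]
      by (simp add: algebra_simps)
    also have "\<dots> \<ge> 0" using Suc by simp
    finally show ?case by (simp only: zero_le_mult_iff) auto
  qed simp
  moreover have "(\<Sum>i\<le>n. sqrt_coeff i) = (-1) ^ n * ((-1/2::real) gchoose n)"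
    using gbinomial_sum_lower_neg [of "1/2::real" n] by (simp add: sqrt_coeff_def mult.commute)
  ultimately show ?thesis by simp
qed

text \<open>All coefficients but the first are nonpositive and the partial sums stay nonnegative.  So the
  series still converges absolutely at \<open>z = 1\<close>, and its tail has total mass at most 1; contractions of
  norm exactly 1 are therefore admissible below.\<close>

lemma sum_abs_sqrt_coeff_Suc_le: "(\<Sum>i<n. \<bar>sqrt_coeff (Suc i)\<bar>) \<le> 1"
proof -
  have "(\<Sum>i<n. \<bar>sqrt_coeff (Suc i)\<bar>) = - (\<Sum>i<n. sqrt_coeff (Suc i))"
    by (simp add: sqrt_coeff_Suc_nonpos abs_of_nonpos sum_negf)
  also have "\<dots> = 1 - (\<Sum>i\<le>n. sqrt_coeff i)"
    by (simp add: sum.atMost_shift)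
  finally show ?thesis using sum_sqrt_coeff_nonneg [of n] by simp
qed

lemma summable_abs_sqrt_coeff: "summable (\<lambda>n. \<bar>sqrt_coeff n\<bar>)"
proof -
  have "summable (\<lambda>n. \<bar>sqrt_coeff (Suc n)\<bar>)"
    by (rule summableI_nonneg_bounded [where x = 1]) (auto intro: sum_abs_sqrt_coeff_Suc_le)
  then show ?thesis by (subst (asm) summable_Suc_iff)
qed

lemma suminf_abs_sqrt_coeff_Suc_le: "(\<Sum>n. \<bar>sqrt_coeff (Suc n)\<bar>) \<le> 1"
proof (rule suminf_le_const)
  show "summable (\<lambda>n. \<bar>sqrt_coeff (Suc n)\<bar>)"
    by (subst summable_Suc_iff) (rule summable_abs_sqrt_coeff)
qed (rule sum_abs_sqrt_coeff_Suc_le)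

definition sqrt_id_minus :: "('b::banach \<Rightarrow> 'b) \<Rightarrow> 'b \<Rightarrow> 'b" where
  "sqrt_id_minus X f = (\<Sum>n. sqrt_coeff n *\<^sub>R (X ^^ n) f)"

locale contraction =
  fixes X :: "'b::banach \<Rightarrow> 'b"
  assumes add: "X (x + y) = X x + X y"
    and scaleR: "X (r *\<^sub>R x) = r *\<^sub>R X x"
    and norm_le: "norm (X x) \<le> norm x"
begin

lemma norm_funpow_le: "norm ((X ^^ n) x) \<le> norm x"
  by (induction n) (auto intro: order_trans [OF norm_le])

lemma bounded_linear_funpow: "bounded_linear (X ^^ n)"
proof (rule bounded_linear_intro [where K = 1])
  show "(X ^^ n) (x + y) = (X ^^ n) x + (X ^^ n) y" for x y
    by (induction n) (auto simp: add)
  show "(X ^^ n) (r *\<^sub>R x) = r *\<^sub>R (X ^^ n) x" for r x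
    by (induction n) (auto simp: scaleR)
qed (simp add: norm_funpow_le)

lemma summable_norm_series: "summable (\<lambda>n. norm (sqrt_coeff n *\<^sub>R (X ^^ n) x))"
proof (rule summable_comparison_test)
  show "summable (\<lambda>n. \<bar>sqrt_coeff n\<bar> * norm x)"
    by (rule summable_mult2 [OF summable_abs_sqrt_coeff])
  show "\<exists>N. \<forall>n\<ge>N. norm (norm (sqrt_coeff n *\<^sub>R (X ^^ n) x)) \<le> \<bar>sqrt_coeff n\<bar> * norm x"
    by (auto intro!: mult_left_mono norm_funpow_le)
qed

lemma sums_sqrt: "(\<lambda>n. sqrt_coeff n *\<^sub>R (X ^^ n) x) sums sqrt_id_minus X x"
  unfolding sqrt_id_minus_def by (rule summable_sums [OF summable_norm_cancel [OF summable_norm_series]])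

lemma has_sum_sqrt: "((\<lambda>n. sqrt_coeff n *\<^sub>R (X ^^ n) x) has_sum sqrt_id_minus X x) UNIV"
  by (rule norm_summable_imp_has_sum [OF summable_norm_series sums_sqrt])

lemma norm_diff_sqrt_le: "norm (x - sqrt_id_minus X x) \<le> norm x"
proof -
  let ?g = "\<lambda>n. sqrt_coeff (Suc n) *\<^sub>R (X ^^ Suc n) x"
  have g: "?g sums (sqrt_id_minus X x - x)"
    using sums_sqrt [of x] sums_Suc_iff [of "\<lambda>n. sqrt_coeff n *\<^sub>R (X ^^ n) x" "sqrt_id_minus X x - x"]
    by simp
  have sg: "summable (\<lambda>n. norm (?g n))"
    using summable_norm_series [of x] summable_Suc_iff [of "\<lambda>n. norm (sqrt_coeff n *\<^sub>R (X ^^ n) x)"]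
    by blast
  have sc: "summable (\<lambda>n. \<bar>sqrt_coeff (Suc n)\<bar>)"
    by (subst summable_Suc_iff) (rule summable_abs_sqrt_coeff)
  have "norm (sqrt_id_minus X x - x) \<le> (\<Sum>n. norm (?g n))"
    using summable_norm [OF sg] g by (simp add: sums_iff)
  also have "\<dots> \<le> (\<Sum>n. \<bar>sqrt_coeff (Suc n)\<bar> * norm x)"
    using norm_funpow_le [of "Suc _" x]
    by (intro suminf_le sg summable_mult2 sc) (auto intro!: mult_left_mono)
  also have "\<dots> = (\<Sum>n. \<bar>sqrt_coeff (Suc n)\<bar>) * norm x"
    by (rule suminf_mult2 [OF sc, symmetric])
  also have "\<dots> \<le> 1 * norm x"
    by (intro mult_right_mono suminf_abs_sqrt_coeff_Suc_le) simp
  finally show ?thesis by (simp add: norm_minus_commute)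
qed

lemma bounded_linear_sqrt: "bounded_linear (sqrt_id_minus X)"
proof (rule bounded_linear_intro [where K = 2])
  fix x y :: 'b and r :: real
  interpret P: bounded_linear "X ^^ n" for n by (rule bounded_linear_funpow)
  show "sqrt_id_minus X (x + y) = sqrt_id_minus X x + sqrt_id_minus X y"
    using sums_add [OF sums_sqrt [of x] sums_sqrt [of y]]
    by (intro sums_unique2 [OF sums_sqrt]) (simp add: P.add scaleR_add_right)
  show "sqrt_id_minus X (r *\<^sub>R x) = r *\<^sub>R sqrt_id_minus X x"
    using sums_scaleR_right [OF sums_sqrt [of x], of r]
    by (intro sums_unique2 [OF sums_sqrt]) (simp add: P.scaleR mult.commute)
  show "norm (sqrt_id_minus X x) \<le> norm x * 2"
    using norm_diff_sqrt_le [of x] norm_triangle_ineq4 [of x "x - sqrt_id_minus X x"] by simp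
qed

text \<open>Every property that the square root inherits from \<open>X\<close> (commutation, linearity over \<open>\<A>\<close>,
  self-adjointness) is an equality of two continuous linear maps, and it suffices to check it on powers.\<close>

lemma sqrt_intertwine:
  assumes "bounded_linear \<phi>" "bounded_linear \<psi>"
    and "\<And>n. \<phi> ((X ^^ n) x) = \<psi> ((X ^^ n) y)"
  shows "\<phi> (sqrt_id_minus X x) = \<psi> (sqrt_id_minus X y)"
proof -
  interpret \<phi>: bounded_linear \<phi> by fact
  interpret \<psi>: bounded_linear \<psi> by fact
  show ?thesis
  proof (rule sums_unique2)
    show "(\<lambda>n. sqrt_coeff n *\<^sub>R \<phi> ((X ^^ n) x)) sums \<phi> (sqrt_id_minus X x)"
      using \<phi>.sums [OF sums_sqrt [of x]] by (simp add: \<phi>.scaleR)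
    show "(\<lambda>n. sqrt_coeff n *\<^sub>R \<phi> ((X ^^ n) x)) sums \<psi> (sqrt_id_minus X y)"
      using \<psi>.sums [OF sums_sqrt [of y]] by (simp add: \<psi>.scaleR assms(3))
  qed
qed

text \<open>The double series of \<open>\<surd>(1 - X) (\<surd>(1 - X) x)\<close> converges absolutely and may be summed along the
  diagonals \<open>m + n = k\<close>, where the coefficients convolve to those of \<open>1 - z\<close>.\<close>

lemma sqrt_squared: "sqrt_id_minus X (sqrt_id_minus X x) = x - X x"
proof -
  let ?R = "sqrt_id_minus X"
  let ?g = "\<lambda>(m, n). (sqrt_coeff m * sqrt_coeff n) *\<^sub>R (X ^^ (m + n)) x"
  let ?p = "\<lambda>(k, i). (i, k - i) :: nat \<times> nat"
  have sc: "(\<lambda>n. \<bar>sqrt_coeff n\<bar>) summable_on UNIV"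
    using summable_abs_sqrt_coeff by (intro norm_summable_imp_summable_on) simp
  have "(\<lambda>z. norm (case z of (m, n) \<Rightarrow> sqrt_coeff m * sqrt_coeff n)) summable_on UNIV \<times> UNIV"
    using sc by (subst Infinite_Sum.abs_summable_on_Sigma_iff)
      (auto simp: abs_mult infsum_cmult_right' infsum_nonneg
        intro!: summable_on_cmult_right summable_on_cmult_left)
  then have "(\<lambda>z. norm (case z of (m, n) \<Rightarrow> sqrt_coeff m * sqrt_coeff n) * norm x) summable_on UNIV \<times> UNIV"
    by (rule summable_on_cmult_left)
  then have "(\<lambda>z. norm (?g z)) summable_on (UNIV \<times> UNIV)"
  proof (rule Infinite_Sum.abs_summable_on_comparison_test')
    show "norm (?g z) \<le> norm (case z of (m, n) \<Rightarrow> sqrt_coeff m * sqrt_coeff n) * norm x" for z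
      by (cases z) (simp add: abs_mult mult_left_mono norm_funpow_le del: funpow.simps)
  qed
  then have g: "?g summable_on (UNIV \<times> UNIV)"
    by (rule abs_summable_summable)
  have inner: "((\<lambda>n. ?g (m, n)) has_sum sqrt_coeff m *\<^sub>R (X ^^ m) (?R x)) UNIV" for m
  proof -
    interpret P: bounded_linear "X ^^ m" by (rule bounded_linear_funpow)
    have "bounded_linear (\<lambda>z. sqrt_coeff m *\<^sub>R (X ^^ m) z)"
      by (intro bounded_linear_scaleR_right [THEN bounded_linear_compose] P.bounded_linear_axioms)
    from has_sum_bounded_linear [OF this has_sum_sqrt [of x]] show ?thesis
      by (simp add: P.scaleR funpow_add o_def)
  qed
  have "infsum ?g (UNIV \<times> UNIV) = ?R (?R x)"
  proof (rule has_sum_unique)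
    show "((\<lambda>m. sqrt_coeff m *\<^sub>R (X ^^ m) (?R x)) has_sum infsum ?g (UNIV \<times> UNIV)) UNIV"
      by (rule has_sum_SigmaD [OF has_sum_infsum [OF g] inner])
  qed (rule has_sum_sqrt)
  moreover have "infsum ?g (UNIV \<times> UNIV) = x - X x"
  proof -
    have bij: "bij_betw ?p (SIGMA k:UNIV. {..k}) (UNIV \<times> UNIV)"
      by (rule bij_betwI [where g = "\<lambda>(m, n). (m + n, m)"]) auto
    have G: "((\<lambda>z. ?g (?p z)) has_sum infsum ?g (UNIV \<times> UNIV)) (SIGMA k:UNIV. {..k})"
      using has_sum_reindex_bij_betw [OF bij, of ?g] has_sum_infsum [OF g] by simp
    have fin: "((\<lambda>i. ?g (?p (k, i))) has_sum
        (if k = 0 then x else if k = 1 then - X x else 0)) {..k}" for k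
    proof -
      have "(\<Sum>i\<le>k. ?g (?p (k, i))) = (\<Sum>i\<le>k. sqrt_coeff i * sqrt_coeff (k - i)) *\<^sub>R (X ^^ k) x"
        by (simp add: scaleR_sum_left)
      then show ?thesis
        using has_sum_finite [of "{..k}" "\<lambda>i. ?g (?p (k, i))"]
        by (auto simp: sqrt_coeff_convolution split: if_splits)
    qed
    have "((\<lambda>k::nat. if k = 0 then x else if k = 1 then - X x else 0) has_sum infsum ?g (UNIV \<times> UNIV)) UNIV"
      using has_sum_SigmaD [where f = "\<lambda>z. ?g (?p z)", OF G fin] by simp
    moreover have "((\<lambda>k. if k = 0 then x else if k = 1 then - X x else 0) has_sum (x - X x)) (UNIV :: nat set)"
      by (rule has_sum_finite_neutralI [where B = "{0, 1}"]) auto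
    ultimately show ?thesis by (rule has_sum_unique)
  qed
  ultimately show ?thesis by simp
qed

end

section \<open>Positivity in a \<open>C\<^sup>*\<close>-algebra\<close>

subsection \<open>The involution\<close>

lemma star_zero [simp]: "star (0::'a::cstar_algebra) = 0"
  using star_add [of "0::'a" 0] by simp

lemma star_minus: "star (- a) = - star (a::'a::cstar_algebra)"
  using star_add [of a "- a"] by (simp add: add_eq_0_iff2 minus_equation_iff)

lemma star_diff: "star (a - b) = star a - star (b::'a::cstar_algebra)"
  using star_add [of a "- b"] by (simp add: star_minus)

lemma star_scaleR: "star (r *\<^sub>R a) = r *\<^sub>R star (a::'a::cstar_algebra)"
  using star_scaleC [of "complex_of_real r" a] by (simp add: scaleC_of_real)

lemma star_one [simp]: "star (1::'a::cstar_algebra) = 1"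
  by (metis mult_1_left mult_1_right star_mult star_star)

lemma norm_star [simp]: "norm (star a) = norm (a::'a::cstar_algebra)"
proof -
  have le: "norm b \<le> norm (star b)" for b :: 'a
  proof (cases "b = 0")
    case False
    have "norm b * norm b \<le> norm (star b) * norm b"
      using norm_mult_ineq [of "star b" b] by (simp add: cstar_identity power2_eq_square)
    then show ?thesis using False by simp
  qed simp
  show ?thesis using le [of a] le [of "star a"] by (simp add: star_star)
qed

lemma bounded_linear_star: "bounded_linear (star :: 'a::cstar_algebra \<Rightarrow> 'a)"
  by (rule bounded_linear_intro [where K = 1]) (auto simp: star_add star_scaleR)

lemma norm_selfadjoint_square: "star h = h \<Longrightarrow> norm (h * h) = (norm (h::'a::cstar_algebra))\<^sup>2"
  using cstar_identity [of h] by simp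

lemmas star_simps = star_add star_minus star_diff star_scaleR star_scaleC star_mult star_star

lemma scaleC_minus_left: "(- c) *\<^sub>C a = - (c *\<^sub>C (a::'a::cstar_algebra))"
  using scaleC_scaleC [of "-1" c a] scaleC_scaleC [of "complex_of_real (-1)" c a]
    scaleC_of_real [of "-1" "c *\<^sub>C a"] by simp

lemma scaleC_ii_ii: "\<i> *\<^sub>C \<i> *\<^sub>C a = - (a::'a::cstar_algebra)"
  using scaleC_of_real [of "-1" a] by (simp add: scaleC_scaleC)

lemma scaleC_one [simp]: "1 *\<^sub>C a = (a::'a::cstar_algebra)"
  using scaleC_of_real [of 1 a] by simp

lemma scaleC_minus_right: "c *\<^sub>C (- a) = - (c *\<^sub>C (a::'a::cstar_algebra))"
  using mult_scaleC_right [of "-1" c a] by simp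

lemma scaleC_diff_right: "c *\<^sub>C (a - b) = c *\<^sub>C a - c *\<^sub>C (b::'a::cstar_algebra)"
  using scaleC_add_right [of c a "- b"] by (simp add: scaleC_minus_right)

lemmas scaleC_simps = mult_scaleC_left mult_scaleC_right scaleC_ii_ii scaleC_add_right
  scaleC_diff_right scaleC_minus_right scaleC_minus_left

text \<open>A commuting pair of self-adjoint elements with \<open>h\<^sup>2 + k\<^sup>2 = 1\<close> consists of the real and
  imaginary part of the unitary \<open>u = h + \<i>k\<close>, and \<open>2h\<^sup>2 - 1\<close> is the real part of \<open>u\<^sup>2\<close>.\<close>

lemma norm_le_one_of_unitary_part:
  fixes h k :: "'a::cstar_algebra"
  assumes h: "star h = h" and k: "star k = k" and comm: "h * k = k * h" and sum: "h * h + k * k = 1"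
  shows "norm h \<le> 1" and "norm (2 *\<^sub>R (h * h) - 1) \<le> 1"
proof -
  define u where "u = h + \<i> *\<^sub>C k"
  have su: "star u = h - \<i> *\<^sub>C k"
    by (simp add: u_def star_simps h k scaleC_minus_left)
  have "star u * u = h * h + k * k"
    unfolding su unfolding u_def
    by (simp add: algebra_simps scaleC_simps comm)
  then have "(norm u)\<^sup>2 = 1"
    using cstar_identity [of u] sum by simp
  then have nu: "norm u = 1" by (simp add: power2_eq_1_iff) (use norm_ge_zero [of u] in linarith)
  have "2 *\<^sub>R h = u + star u" unfolding su by (simp add: u_def scaleR_2)
  then have "norm (2 *\<^sub>R h) \<le> norm u + norm (star u)" by (metis norm_triangle_ineq)
  then show "norm h \<le> 1" by (simp add: nu)
  have "2 *\<^sub>R (2 *\<^sub>R (h * h) - 1) = 2 *\<^sub>R (h * h - k * k)"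
    unfolding sum [symmetric] by (simp add: scaleR_2 algebra_simps)
  also have "\<dots> = u * u + star u * star u"
    unfolding su unfolding u_def
    by (simp add: algebra_simps scaleC_simps scaleR_2)
  finally have "norm (2 *\<^sub>R (2 *\<^sub>R (h * h) - 1)) \<le> norm (u * u) + norm (star u * star u)"
    by (metis norm_triangle_ineq)
  also have "\<dots> \<le> 1 + 1"
    using norm_mult_ineq [of u u] norm_mult_ineq [of "star u" "star u"] by (simp add: nu)
  finally show "norm (2 *\<^sub>R (h * h) - 1) \<le> 1" by simp
qed

text \<open>Applied to left multiplication by \<open>x\<close>, the square root of operators becomes left multiplication by
  its value \<open>s\<close> at 1.\<close>

lemma sqrt_one_minus:
  fixes x :: "'a::cstar_algebra"
  assumes x: "star x = x" "norm x \<le> 1"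
  obtains s where "star s = s" "s * s = 1 - x" "norm (1 - s) \<le> 1"
    "\<And>b. b * x = x * b \<Longrightarrow> b * s = s * b"
proof -
  interpret contraction "(*) x"
  proof
    show "norm (x * y) \<le> norm y" for y
      using norm_mult_ineq [of x y] mult_right_mono [OF x(2) norm_ge_zero [of y]] by simp
  qed (simp_all add: algebra_simps)
  define s where "s = sqrt_id_minus ((*) x) 1"
  have pow: "((*) x ^^ n) y = x ^ n * y" for n y
    by (induction n) (simp_all add: mult.assoc)
  have star_pow: "star (x ^ n) = x ^ n" for n
    by (induction n) (simp_all add: star_mult x power_commutes)
  have "star s = s"
    unfolding s_def
    by (rule sqrt_intertwine [OF bounded_linear_star bounded_linear_ident]) (simp add: pow star_pow)
  moreover have left: "sqrt_id_minus ((*) x) z = s * z" for z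
    unfolding s_def
    by (rule sqrt_intertwine [OF bounded_linear_ident bounded_linear_mult_left]) (simp add: pow)
  have "s * s = 1 - x"
    using sqrt_squared [of 1] by (simp add: left)
  moreover have "norm (1 - s) \<le> 1"
    using norm_diff_sqrt_le [of 1] by (simp add: s_def)
  moreover have "b * s = s * b" if b: "b * x = x * b" for b
  proof -
    have "b * x ^ n = x ^ n * b" for n
      by (induction n) (simp_all add: b mult.assoc, metis b mult.assoc)
    then show ?thesis
      unfolding s_def
      by (intro sqrt_intertwine [OF bounded_linear_mult_right bounded_linear_mult_left])
        (simp add: pow)
  qed
  ultimately show ?thesis by (rule that)
qed

subsection \<open>A norm criterion for positivity\<close>

text \<open>For self-adjoint \<open>a\<close> with spectrum in \<open>[-r, r]\<close>, \<open>r = \<parallel>a\<parallel>\<close>, the spectrum is nonnegative iff that of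
  \<open>r - a\<close> lies in \<open>[-r, r]\<close>.  The latter is expressed by the norm, and defines a closed set.\<close>

definition norm_pos :: "'a::cstar_algebra \<Rightarrow> bool" where
  "norm_pos a \<longleftrightarrow> star a = a \<and> norm (norm a *\<^sub>R 1 - a) \<le> norm a"

lemma norm_pos_star: "norm_pos a \<Longrightarrow> star a = a"
  by (simp add: norm_pos_def)

lemma norm_pos_0 [simp]: "norm_pos 0"
  by (simp add: norm_pos_def)

text \<open>For \<open>\<parallel>k\<parallel> = 1\<close>, completing \<open>k\<close> by \<open>\<surd>(1 - k\<^sup>2)\<close> to a unitary gives \<open>\<parallel>2k\<^sup>2 - 1\<parallel> \<le> 1\<close>, and
  \<open>1 - k\<^sup>2\<close> is the mean of 1 and \<open>1 - 2k\<^sup>2\<close>.\<close>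

lemma norm_pos_square:
  fixes h :: "'a::cstar_algebra"
  assumes h: "star h = h"
  shows "norm_pos (h * h)"
proof (cases "h = 0")
  case False
  define r where "r = (norm h)\<^sup>2"
  have r: "r > 0" "norm (h * h) = r" using False h by (simp_all add: r_def norm_selfadjoint_square)
  define k where "k = (1 / norm h) *\<^sub>R h"
  have k: "star k = k" "norm k = 1" using False h by (simp_all add: k_def star_scaleR)
  have kk: "star (k * k) = k * k" "norm (k * k) \<le> 1"
    using k by (simp_all add: star_mult norm_selfadjoint_square)
  obtain s where s: "star s = s" "s * s = 1 - k * k" "\<And>b. b * (k * k) = (k * k) * b \<Longrightarrow> b * s = s * b"
    using sqrt_one_minus [OF kk] by metis
  have "norm (2 *\<^sub>R (k * k) - 1) \<le> 1"
    by (rule norm_le_one_of_unitary_part(2) [OF k(1) s(1)]) (use s in \<open>simp_all add: mult.assoc\<close>)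
  moreover have kkr: "h * h = r *\<^sub>R (k * k)"
    using False by (simp add: k_def r_def power2_eq_square)
  ultimately have "norm (1 - k * k) \<le> 1"
    using norm_triangle_ineq4 [of "1 - 2 *\<^sub>R (k * k)" "-1"] norm_minus_commute [of "2 *\<^sub>R (k * k)" 1]
      norm_scaleR [of 2 "1 - k * k"]
    by (simp add: scaleR_2 algebra_simps)
  then have "norm (r *\<^sub>R (1 - k * k)) \<le> r" using r by simp
  then have "norm (r *\<^sub>R 1 - h * h) \<le> r" by (simp add: kkr scaleR_diff_right)
  then show ?thesis using r h by (simp add: norm_pos_def star_mult)
qed simp

text \<open>The bound on \<open>\<surd>M - s\<close> has the form of the criterion again, so the root is itself positive.\<close>

lemma norm_pos_sqrt_aux:
  fixes a :: "'a::cstar_algebra"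
  assumes a: "star a = a" and M: "norm (M *\<^sub>R 1 - a) \<le> M"
  obtains s where "star s = s" "s * s = a" "norm (sqrt M *\<^sub>R 1 - s) \<le> sqrt M"
    "\<And>b. b * a = a * b \<Longrightarrow> b * s = s * b"
proof (cases "M = 0")
  case True
  then show ?thesis using M that [of 0] by simp
next
  case False
  then have M0: "M > 0" using M norm_ge_zero [of "M *\<^sub>R 1 - a"] by linarith
  define x where "x = 1 - (1 / M) *\<^sub>R a"
  have Mx: "M *\<^sub>R x = M *\<^sub>R 1 - a" using M0 by (simp add: x_def scaleR_diff_right)
  then have "M * norm x \<le> M" using M M0 by (metis norm_scaleR abs_of_pos)
  then have x: "star x = x" "norm x \<le> 1"
    using M0 a by (simp_all add: x_def star_diff star_scaleR)
  obtain s where s: "star s = s" "s * s = 1 - x" "norm (1 - s) \<le> 1"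
    "\<And>b. b * x = x * b \<Longrightarrow> b * s = s * b"
    using sqrt_one_minus [OF x] by metis
  show ?thesis
  proof (rule that [of "sqrt M *\<^sub>R s"])
    show "star (sqrt M *\<^sub>R s) = sqrt M *\<^sub>R s" by (simp add: s star_scaleR)
    show "(sqrt M *\<^sub>R s) * (sqrt M *\<^sub>R s) = a" using M0 by (simp add: s x_def)
    have "sqrt M *\<^sub>R 1 - sqrt M *\<^sub>R s = sqrt M *\<^sub>R (1 - s)" by (simp add: scaleR_diff_right)
    then show "norm (sqrt M *\<^sub>R 1 - sqrt M *\<^sub>R s) \<le> sqrt M"
      using M0 s(3) by simp
    show "b * (sqrt M *\<^sub>R s) = (sqrt M *\<^sub>R s) * b" if "b * a = a * b" for b
      using s(4) [of b] that by (simp add: x_def algebra_simps)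
  qed
qed

text \<open>The constant in the criterion may be any \<open>M\<close>: the bound exhibits \<open>a\<close> as a square.\<close>

lemma norm_posI:
  fixes a :: "'a::cstar_algebra"
  assumes "star a = a" and "norm (M *\<^sub>R 1 - a) \<le> M"
  shows "norm_pos a"
  using norm_pos_sqrt_aux [OF assms] norm_pos_square by metis

lemma norm_pos_sqrt:
  fixes a :: "'a::cstar_algebra"
  assumes "norm_pos a"
  obtains s where "norm_pos s" "s * s = a" "\<And>b. b * a = a * b \<Longrightarrow> b * s = s * b"
proof -
  have a: "star a = a" "norm (norm a *\<^sub>R 1 - a) \<le> norm a" using assms by (auto simp: norm_pos_def)
  show ?thesis
    using norm_pos_sqrt_aux [OF a] norm_posI that by metis
qed

lemma norm_pos_add:
  assumes "norm_pos a" "norm_pos b"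
  shows "norm_pos (a + b)"
proof (rule norm_posI [where M = "norm a + norm b"])
  show "star (a + b) = a + b" using assms by (simp add: norm_pos_def star_add)
  have "(norm a + norm b) *\<^sub>R 1 - (a + b) = (norm a *\<^sub>R 1 - a) + (norm b *\<^sub>R 1 - b)"
    by (simp add: scaleR_add_left)
  moreover have "norm ((norm a *\<^sub>R 1 - a) + (norm b *\<^sub>R 1 - b)) \<le> norm a + norm b"
    using assms by (intro norm_triangle_le add_mono) (auto simp: norm_pos_def)
  ultimately show "norm ((norm a + norm b) *\<^sub>R 1 - (a + b)) \<le> norm a + norm b"
    by (simp only:)
qed

lemma norm_pos_scaleR: "norm_pos a \<Longrightarrow> 0 \<le> r \<Longrightarrow> norm_pos (r *\<^sub>R a)"
proof (rule norm_posI [where M = "r * norm a"])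
  assume a: "norm_pos a" and r: "0 \<le> r"
  show "star (r *\<^sub>R a) = r *\<^sub>R a" using a by (simp add: norm_pos_def star_scaleR)
  have "(r * norm a) *\<^sub>R 1 - r *\<^sub>R a = r *\<^sub>R (norm a *\<^sub>R 1 - a)" by (simp add: scaleR_diff_right)
  then show "norm ((r * norm a) *\<^sub>R 1 - r *\<^sub>R a) \<le> r * norm a"
    using a r by (simp add: norm_pos_def mult_left_mono)
qed

lemma norm_pos_bound_minus:
  fixes a :: "'a::cstar_algebra"
  assumes "star a = a" and "norm a \<le> M"
  shows "norm_pos (M *\<^sub>R 1 - a)"
  by (rule norm_posI [where M = M]) (use assms in \<open>simp_all add: star_diff star_scaleR\<close>)

lemma norm_pos_one [simp]: "norm_pos 1"
  using norm_pos_square [of 1] by simp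

lemma closed_norm_pos: "closed {a :: 'a::cstar_algebra. norm_pos a}"
proof -
  have "continuous_on UNIV (star :: 'a \<Rightarrow> 'a)"
    by (rule linear_continuous_on [OF bounded_linear_star])
  then show ?thesis
    unfolding norm_pos_def
    by (intro closed_Collect_conj closed_Collect_eq closed_Collect_le continuous_intros)
qed

lemma norm_pos_limit:
  fixes a :: "'a::cstar_algebra"
  assumes "\<And>r. 0 < r \<Longrightarrow> norm_pos (a + r *\<^sub>R b)"
  shows "norm_pos a"
proof -
  have "(\<lambda>n. a + inverse (real (Suc n)) *\<^sub>R b) \<longlonglongrightarrow> a + 0 *\<^sub>R b"
    by (intro tendsto_intros LIMSEQ_inverse_real_of_nat)
  then show ?thesis
    using closed_sequentially [OF closed_norm_pos, of "\<lambda>n. a + inverse (real (Suc n)) *\<^sub>R b"] assms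
    by simp
qed

lemma norm_pos_has_sum:
  fixes f :: "'j \<Rightarrow> 'a::cstar_algebra"
  assumes "(f has_sum S) J" and "\<And>j. j \<in> J \<Longrightarrow> norm_pos (f j)"
  shows "norm_pos S"
proof -
  have "norm_pos (sum f F)" if "finite F" "F \<subseteq> J" for F
    using that by (induction F) (auto intro: norm_pos_add assms(2))
  then have "\<forall>\<^sub>F F in finite_subsets_at_top J. sum f F \<in> {a. norm_pos a}"
    by (intro eventually_finite_subsets_at_top_weakI) auto
  then have "S \<in> {a. norm_pos a}"
    by (intro Lim_in_closed_set [OF closed_norm_pos _ finite_subsets_at_top_neq_bot])
      (use assms(1) in \<open>auto simp: has_sum_def\<close>)
  then show ?thesis by simp
qed

text \<open>The commuting square roots of \<open>a\<close> and \<open>1 - a\<close> are the two parts of a unitary.\<close>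

lemma norm_pos_le_one:
  fixes a :: "'a::cstar_algebra"
  assumes "norm_pos a" and "norm_pos (1 - a)"
  shows "norm a \<le> 1"
proof -
  obtain t where t: "norm_pos t" "t * t = a" "\<And>b. b * a = a * b \<Longrightarrow> b * t = t * b"
    using norm_pos_sqrt [OF assms(1)] by metis
  obtain s where s: "norm_pos s" "s * s = 1 - a" "\<And>b. b * (1 - a) = (1 - a) * b \<Longrightarrow> b * s = s * b"
    using norm_pos_sqrt [OF assms(2)] by metis
  have "t * a = a * t" by (simp add: t(2) [symmetric] mult.assoc)
  then have "t * s = s * t" by (intro s(3)) (simp add: algebra_simps)
  have "norm t \<le> 1"
    using norm_le_one_of_unitary_part(1) [of t s] t(1,2) s(1,2) \<open>t * s = s * t\<close>
    by (simp add: norm_pos_def)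
  then show ?thesis
    using t(1,2) by (auto simp: norm_pos_def norm_selfadjoint_square power_le_one)
qed

lemma norm_pos_mono:
  fixes h k :: "'a::cstar_algebra"
  assumes "norm_pos h" and "norm_pos k"
  shows "norm h \<le> norm (h + k)"
proof (rule dense_ge)
  fix M assume M: "norm (h + k) < M"
  then have M0: "M > 0" using norm_ge_zero [of "h + k"] by linarith
  have "norm_pos (M *\<^sub>R 1 - (h + k))"
    using M assms by (intro norm_pos_bound_minus) (auto simp: norm_pos_def star_add)
  then have "norm_pos ((1 / M) *\<^sub>R ((M *\<^sub>R 1 - (h + k)) + k))"
    using M0 assms by (intro norm_pos_scaleR norm_pos_add) auto
  then have "norm_pos (1 - (1 / M) *\<^sub>R h)"
    using M0 by (simp add: scaleR_diff_right)
  then have "norm ((1 / M) *\<^sub>R h) \<le> 1"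
    using M0 assms by (intro norm_pos_le_one norm_pos_scaleR) auto
  then show "norm h \<le> M" using M0 by simp
qed

lemma norm_pos_antisym: "norm_pos a \<Longrightarrow> norm_pos (- a) \<Longrightarrow> a = 0"
  using norm_pos_mono [of a "- a"] by simp

lemma norm_pos_mult:
  assumes "norm_pos a" "norm_pos b" and ab: "a * b = b * a"
  shows "norm_pos (a * b)"
proof -
  obtain s where s: "norm_pos s" "s * s = a" "\<And>c. c * a = a * c \<Longrightarrow> c * s = s * c"
    using norm_pos_sqrt [OF assms(1)] by metis
  obtain t where t: "norm_pos t" "t * t = b" "\<And>c. c * b = b * c \<Longrightarrow> c * t = t * c"
    using norm_pos_sqrt [OF assms(2)] by metis
  have "b * s = s * b" using s(3) ab by simp
  then have st: "s * t = t * s" using t(3) [of s] by simp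
  have "(s * t) * (s * t) = s * (t * s) * t" by (simp add: mult.assoc)
  also have "\<dots> = a * b" by (simp add: s(2) [symmetric] t(2) [symmetric] st [symmetric] mult.assoc)
  finally show ?thesis
    using norm_pos_square [of "s * t"] s(1) t(1) st by (simp add: star_mult norm_pos_def)
qed

subsection \<open>The norm criterion and the spectrum\<close>

lemma alg_invertible_one_minus:
  fixes x :: "'a::cstar_algebra"
  assumes "norm x < 1"
  shows "alg_invertible (1 - x)"
proof -
  have s: "summable (\<lambda>n. x ^ n)"
    by (rule summable_norm_cancel, rule summable_comparison_test [OF _ summable_geometric [of "norm x"]])
      (use assms in \<open>auto intro!: norm_power_ineq\<close>)
  let ?s = "\<Sum>n. x ^ n"
  have "x * ?s = ?s - 1"
    using suminf_mult [OF s, of x] suminf_split_head [OF s] by simp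
  moreover have "?s * x = ?s - 1"
    using suminf_mult2 [OF s, of x] suminf_split_head [OF s] by (simp add: power_commutes)
  ultimately show ?thesis
    unfolding alg_invertible_def by (intro exI [of _ ?s]) (simp add: algebra_simps)
qed

lemma alg_invertible_minus_scaleC:
  fixes y :: "'a::cstar_algebra"
  assumes "norm y < cmod c"
  shows "alg_invertible (y - c *\<^sub>C 1)"
proof -
  have c: "c \<noteq> 0" using assms norm_ge_zero [of y] by auto
  have "norm (inverse c *\<^sub>C y) < 1"
    using assms c by (simp add: norm_scaleC norm_inverse divide_inverse [symmetric] mult.commute del: inverse_eq_divide)
  then obtain b where b: "(1 - inverse c *\<^sub>C y) * b = 1" "b * (1 - inverse c *\<^sub>C y) = 1"
    using alg_invertible_one_minus by (auto simp: alg_invertible_def)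
  have y: "y - c *\<^sub>C 1 = (- c) *\<^sub>C (1 - inverse c *\<^sub>C y)"
    using c by (simp add: scaleC_minus_left scaleC_diff_right scaleC_scaleC)
  show ?thesis
    unfolding alg_invertible_def y
    by (rule exI [of _ "inverse (- c) *\<^sub>C b"])
      (use b c in \<open>simp add: mult_scaleC_left mult_scaleC_right scaleC_scaleC\<close>)
qed

lemma norm_pos_invertible:
  fixes a :: "'a::cstar_algebra"
  assumes "norm_pos (a - t *\<^sub>R 1)" and "0 < t"
  shows "alg_invertible a"
proof -
  define M where "M = norm (a - t *\<^sub>R 1)"
  have "norm ((M + t) *\<^sub>R 1 - a) < cmod (complex_of_real (M + t))"
    using assms norm_ge_zero [of "a - t *\<^sub>R 1"]
    unfolding norm_pos_def M_def [symmetric] norm_of_real by (simp add: scaleR_add_left algebra_simps)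
  from alg_invertible_minus_scaleC [OF this]
  have "alg_invertible (- a)" by (simp only: scaleC_of_real) (simp add: algebra_simps)
  then show ?thesis
    unfolding alg_invertible_def by (metis minus_mult_minus minus_minus)
qed

text \<open>Arens' argument: a spectral value \<open>c\<close> of \<open>a\<close> gives the spectral value \<open>c + \<i>t\<close> of \<open>a + \<i>t\<close>, whose norm
  grows too slowly in \<open>t\<close> unless \<open>c\<close> is real.\<close>

lemma selfadjoint_spectrum_real:
  fixes a :: "'a::cstar_algebra"
  assumes a: "star a = a" and c: "c \<in> alg_spectrum a"
  shows "Im c = 0"
proof (rule ccontr)
  assume im: "Im c \<noteq> 0"
  have bound: "(Re c)\<^sup>2 + (Im c + t)\<^sup>2 \<le> (norm a)\<^sup>2 + t\<^sup>2" for t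
  proof -
    define w where "w = \<i> * complex_of_real t"
    have cnj_w: "cnj w = - w" and ww: "w * w = complex_of_real (- t\<^sup>2)"
      by (simp_all add: w_def power2_eq_square mult_ac flip: mult.assoc [of \<i> \<i>])
    define y where "y = a + w *\<^sub>C 1"
    have "y - (c + w) *\<^sub>C 1 = a - c *\<^sub>C 1"
      by (simp add: y_def scaleC_add_left)
    then have "\<not> norm y < cmod (c + w)"
      using c alg_invertible_minus_scaleC [of y "c + w"]
      by (auto simp: alg_spectrum_def)
    then have "(cmod (c + w))\<^sup>2 \<le> (norm y)\<^sup>2"
      by (intro power_mono) auto
    also have "\<dots> = norm (star y * y)" by (simp add: cstar_identity)
    also have "star y * y = a * a - w *\<^sub>C w *\<^sub>C 1"
      by (simp add: y_def star_simps a cnj_w algebra_simps scaleC_simps)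
    also have "\<dots> = a * a + (t\<^sup>2) *\<^sub>R 1"
      using scaleC_of_real [of "- t\<^sup>2" "1 :: 'a"] by (simp add: scaleC_scaleC ww)
    also have "norm (a * a + (t\<^sup>2) *\<^sub>R 1) \<le> (norm a)\<^sup>2 + t\<^sup>2"
      using norm_triangle_ineq [of "a * a" "(t\<^sup>2) *\<^sub>R 1"] a by (simp add: norm_selfadjoint_square)
    finally show ?thesis by (simp add: cmod_power2 w_def)
  qed
  \<comment> \<open>The bound reads \<open>\<bar>c\<bar>\<^sup>2 + 2t Im c \<le> norm a\<^sup>2\<close>; this \<open>t\<close> makes the second summand too large.\<close>
  have "(Re c)\<^sup>2 + (Im c)\<^sup>2 + ((norm a)\<^sup>2 + 1) \<le> (norm a)\<^sup>2"
    using bound [of "((norm a)\<^sup>2 + 1) / (2 * Im c)"] im by (simp add: power2_sum)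
  then show False by (smt (verit) zero_le_power2)
qed

lemma norm_pos_imp_cstar_pos:
  fixes a :: "'a::cstar_algebra"
  assumes "norm_pos a"
  shows "cstar_pos a"
proof -
  have a: "star a = a" "norm (norm a *\<^sub>R 1 - a) \<le> norm a" using assms by (auto simp: norm_pos_def)
  have "\<exists>r. c = complex_of_real r \<and> r \<ge> 0" if c: "c \<in> alg_spectrum a" for c
  proof -
    have c_real: "c = complex_of_real (Re c)"
      using selfadjoint_spectrum_real [OF a(1) c] by (simp add: complex_eq_iff)
    have "Re c \<ge> 0"
    proof (rule ccontr)
      assume neg: "\<not> Re c \<ge> 0"
      have "norm (a - norm a *\<^sub>R 1) < cmod (complex_of_real (Re c - norm a))"
        using a neg norm_ge_zero [of a] unfolding norm_of_real by (simp add: norm_minus_commute)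
      from alg_invertible_minus_scaleC [OF this]
      have "alg_invertible (a - c *\<^sub>C 1)"
        by (subst c_real) (simp only: scaleC_of_real, simp add: scaleR_diff_left)
      then show False using c by (simp add: alg_spectrum_def)
    qed
    then show ?thesis using c_real by blast
  qed
  then show ?thesis using a by (auto simp: cstar_pos_def)
qed

text \<open>Multiplying \<open>b\<^sup>-\<^sup>1 \<le> \<parallel>b\<^sup>-\<^sup>1\<parallel>\<close> by \<open>b\<close> bounds \<open>b\<close> from below.\<close>

lemma norm_pos_invertible_lower:
  fixes b :: "'a::cstar_algebra"
  assumes b: "norm_pos b" and "alg_invertible b"
  obtains \<delta> where "0 < \<delta>" "norm_pos (b - \<delta> *\<^sub>R 1)"
proof -
  obtain c where c: "b * c = 1" "c * b = 1" using assms by (auto simp: alg_invertible_def)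
  have star_c: "star c = c"
    by (metis b c mult.assoc mult_1_left mult_1_right norm_pos_star star_mult star_one)
  obtain s where s: "norm_pos s" "s * s = b" "\<And>d. d * b = b * d \<Longrightarrow> d * s = s * d"
    using norm_pos_sqrt [OF b] by metis
  have cs: "c * s = s * c" using s(3) [of c] c by simp
  have "norm_pos (norm c *\<^sub>R 1 - c)" using star_c by (intro norm_pos_bound_minus) auto
  then have "norm_pos ((norm c *\<^sub>R 1 - c) * b)"
    using b c by (intro norm_pos_mult) (auto simp: algebra_simps)
  then have "norm_pos (norm c *\<^sub>R b - 1)" using c by (simp add: algebra_simps)
  moreover have "norm c > 0" using c by auto
  ultimately have "norm_pos ((1 / norm c) *\<^sub>R (norm c *\<^sub>R b - 1))"
    by (intro norm_pos_scaleR) auto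
  with \<open>norm c > 0\<close> have "norm_pos (b - (1 / norm c) *\<^sub>R 1)" by (simp add: scaleR_diff_right)
  then show ?thesis using \<open>norm c > 0\<close> by (intro that [of "1 / norm c"]) auto
qed

text \<open>The set of \<open>t \<ge> 0\<close> with \<open>a + t \<ge> 0\<close> is closed.  At a positive infimum \<open>t\<^sub>0\<close> the element \<open>a + t\<^sub>0\<close> would be
  positive and invertible, hence bounded below, and \<open>t\<^sub>0\<close> could be lowered.\<close>

lemma norm_pos_if_shifts_invertible:
  fixes a :: "'a::cstar_algebra"
  assumes a: "star a = a" and inv: "\<And>t. 0 < t \<Longrightarrow> alg_invertible (a + t *\<^sub>R 1)"
  shows "norm_pos a"
proof -
  define T where "T = {t. 0 \<le> t \<and> norm_pos (a + t *\<^sub>R 1)}"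
  have "closed ((\<lambda>t. a + t *\<^sub>R 1) -` {x. norm_pos x})"
    by (intro closed_vimage closed_norm_pos continuous_intros)
  then have "closed T"
    unfolding T_def vimage_def by (intro closed_Collect_conj closed_Collect_le continuous_intros) auto
  moreover have "norm a \<in> T"
    using a by (auto simp: T_def star_add star_scaleR intro!: norm_posI [where M = "norm a"])
  moreover have bdd: "bdd_below T" by (auto simp: T_def bdd_below_def)
  ultimately have t0: "Inf T \<in> T" using closed_contains_Inf by blast
  have "\<not> Inf T > 0"
  proof
    assume pos: "Inf T > 0"
    have "norm_pos (a + Inf T *\<^sub>R 1)" using t0 by (simp add: T_def)
    then obtain \<delta> where \<delta>: "0 < \<delta>" "norm_pos (a + Inf T *\<^sub>R 1 - \<delta> *\<^sub>R 1)"
      using norm_pos_invertible_lower inv [OF pos] by metis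
    define t where "t = Inf T - min \<delta> (Inf T)"
    have "norm_pos ((a + Inf T *\<^sub>R 1 - \<delta> *\<^sub>R 1) + (\<delta> - min \<delta> (Inf T)) *\<^sub>R 1)"
      using \<delta> by (intro norm_pos_add norm_pos_scaleR) auto
    then have "norm_pos (a + t *\<^sub>R 1)" by (simp add: t_def algebra_simps)
    then have "t \<in> T" by (simp add: T_def t_def)
    then have "Inf T \<le> t" using bdd by (intro cInf_lower)
    then show False using \<delta> pos by (simp add: t_def min_def split: if_splits)
  qed
  then have "Inf T = 0" using t0 by (simp add: T_def)
  then show ?thesis using t0 by (simp add: T_def)
qed

lemma cstar_pos_iff_norm_pos: "cstar_pos a \<longleftrightarrow> norm_pos (a::'a::cstar_algebra)"
proof
  assume pos: "cstar_pos a"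
  have "alg_invertible (a + t *\<^sub>R 1)" if "0 < t" for t
  proof (rule ccontr)
    assume "\<not> alg_invertible (a + t *\<^sub>R 1)"
    moreover have "a + t *\<^sub>R 1 = a - complex_of_real (- t) *\<^sub>C 1"
      unfolding scaleC_of_real by simp
    ultimately have "complex_of_real (- t) \<in> alg_spectrum a"
      by (simp add: alg_spectrum_def)
    then obtain r where "complex_of_real (- t) = complex_of_real r" "r \<ge> 0"
      using pos unfolding cstar_pos_def by blast
    then have "- t \<ge> 0" by (simp only: of_real_eq_iff)
    then show False using that by simp
  qed
  then show "norm_pos a" using pos by (intro norm_pos_if_shifts_invertible) (auto simp: cstar_pos_def)
qed (rule norm_pos_imp_cstar_pos)

subsection \<open>Elements of the form \<open>a\<^sup>*a\<close>\<close>

text \<open>Up to 0, \<open>xy\<close> and \<open>yx\<close> have the same spectrum: if \<open>e\<close> inverts \<open>xy + t\<close> then \<open>(1 - yex)/t\<close> inverts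
  \<open>yx + t\<close>.\<close>

lemma norm_pos_swap:
  fixes x y :: "'a::cstar_algebra"
  assumes xy: "norm_pos (x * y)" and yx: "star (y * x) = y * x"
  shows "norm_pos (y * x)"
proof (rule norm_pos_if_shifts_invertible [OF yx])
  fix t :: real assume t: "0 < t"
  have "alg_invertible (x * y + t *\<^sub>R 1)" by (rule norm_pos_invertible [OF _ t]) (simp add: xy)
  then obtain e where e: "(x * y + t *\<^sub>R 1) * e = 1" "e * (x * y + t *\<^sub>R 1) = 1"
    by (auto simp: alg_invertible_def)
  have "(y * x + t *\<^sub>R 1) * (1 - y * e * x) = y * x + t *\<^sub>R 1 - y * ((x * y + t *\<^sub>R 1) * e) * x"
    by (simp add: algebra_simps)
  then have r: "(y * x + t *\<^sub>R 1) * (1 - y * e * x) = t *\<^sub>R 1" by (simp add: e)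
  have "(1 - y * e * x) * (y * x + t *\<^sub>R 1) = y * x + t *\<^sub>R 1 - y * (e * (x * y + t *\<^sub>R 1)) * x"
    by (simp add: algebra_simps)
  then have l: "(1 - y * e * x) * (y * x + t *\<^sub>R 1) = t *\<^sub>R 1" by (simp add: e)
  show "alg_invertible (y * x + t *\<^sub>R 1)"
    unfolding alg_invertible_def
    by (rule exI [of _ "(1 / t) *\<^sub>R (1 - y * e * x)"]) (use t in \<open>simp add: l r\<close>)
qed

text \<open>For \<open>p = \<bar>b\<bar>\<close>, the product \<open>(p + t - b)(p + t + b) = 2tp + t\<^sup>2\<close> is invertible, hence so is the shift
  \<open>p - b + t\<close>.\<close>

lemma norm_pos_abs:
  fixes b :: "'a::cstar_algebra"
  assumes b: "star b = b"
  obtains p where "norm_pos p" "p * p = b * b" "p * b = b * p" "norm_pos (p - b)"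
proof -
  obtain p where p: "norm_pos p" "p * p = b * b" "\<And>c. c * (b * b) = (b * b) * c \<Longrightarrow> c * p = p * c"
    using norm_pos_sqrt [OF norm_pos_square [OF b]] by metis
  have pb: "p * b = b * p" using p(3) [of b] by (simp add: mult.assoc)
  have "norm_pos (p - b)"
  proof (rule norm_pos_if_shifts_invertible)
    show "star (p - b) = p - b" using b p(1) by (simp add: norm_pos_def star_diff)
    fix t :: real assume t: "0 < t"
    define x y where "x = p - b + t *\<^sub>R 1" and "y = p + b + t *\<^sub>R 1"
    have xy: "x * y = (2 * t) *\<^sub>R p + (t * t) *\<^sub>R 1" and yx: "y * x = x * y"
      by (simp_all add: x_def y_def algebra_simps pb p(2) scaleR_2 flip: scaleR_scaleR)
    have "norm_pos (x * y - (t * t) *\<^sub>R 1)" using t p(1) by (simp add: xy norm_pos_scaleR)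
    then have "alg_invertible (x * y)" by (rule norm_pos_invertible) (use t in simp)
    then obtain e where "x * y * e = 1" "e * (x * y) = 1" by (auto simp: alg_invertible_def)
    then have "x * (y * e) = 1" "e * y * x = 1" using yx by (simp_all add: mult.assoc)
    moreover from this have "e * y = y * e" by (metis mult.assoc mult_1_left mult_1_right)
    ultimately show "alg_invertible (p - b + t *\<^sub>R 1)"
      unfolding alg_invertible_def x_def [symmetric] by metis
  qed
  then show ?thesis using p(1,2) pb that by blast
qed

text \<open>With \<open>b = a\<^sup>*a\<close> and \<open>m = \<bar>b\<bar> - b\<close>, twice the negative part of \<open>b\<close>, the element \<open>z = a m\<close> satisfies
  \<open>2z\<^sup>*z = -m\<^sup>3 \<le> 0\<close>.  Then \<open>zz\<^sup>* \<le> 0\<close> as well, but \<open>zz\<^sup>* + z\<^sup>*z\<close> is a sum of squares; so \<open>z\<^sup>*z\<close> vanishes and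
  with it \<open>m\<close>.\<close>

lemma norm_pos_star_mult:
  fixes a :: "'a::cstar_algebra"
  shows "norm_pos (star a * a)"
proof -
  define b where "b = star a * a"
  have b: "star b = b" by (simp add: b_def star_mult star_star)
  obtain p where p: "norm_pos p" "p * p = b * b" "p * b = b * p" "norm_pos (p - b)"
    using norm_pos_abs [OF b] by metis
  define m z where "m = p - b" and "z = a * m"
  have m: "norm_pos m" "star m = m" using p by (simp_all add: m_def norm_pos_def)
  have pb: "p * (b * x) = b * (p * x)" and pp: "p * (p * x) = b * (b * x)" for x
    by (simp_all add: p(2,3) flip: mult.assoc)
  have "2 *\<^sub>R (m * b * m) = - (m * (m * m))"
    by (simp add: m_def algebra_simps p(2,3) pp pb scaleR_2)
  then have mbm: "2 *\<^sub>R (star z * z) = - (m * (m * m))"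
    by (simp add: z_def b_def star_mult m mult.assoc)
  have m3: "norm_pos (m * (m * m))"
    using m by (intro norm_pos_mult norm_pos_square) (auto simp: mult.assoc)
  have "norm_pos ((1/2) *\<^sub>R (m * (m * m)))" using m3 by (intro norm_pos_scaleR) auto
  moreover have "(1/2) *\<^sub>R (m * (m * m)) = (- star z) * z"
    using mbm by (metis mult_minus_left scaleR_half_double scaleR_2 minus_minus scaleR_minus_right)
  ultimately have neg: "norm_pos ((- star z) * z)" by simp
  then have swap: "norm_pos (z * (- star z))"
    by (rule norm_pos_swap) (simp add: star_simps)
  \<comment> \<open>Twice the real part and, up to sign, twice the imaginary part of \<open>z\<close>.\<close>
  define c d where "c = z + star z" and "d = \<i> *\<^sub>C (z - star z)"
  have "star c = c" "star d = d"
    by (simp_all add: c_def d_def star_simps scaleC_minus_left scaleC_diff_right)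
  then have "norm_pos (c * c + d * d)" by (intro norm_pos_add norm_pos_square)
  moreover have "c * c + d * d + 2 *\<^sub>R (z * (- star z)) = 2 *\<^sub>R (star z * z)"
    by (simp add: c_def d_def algebra_simps scaleC_simps scaleR_2)
  ultimately have "norm_pos (2 *\<^sub>R (star z * z))"
    using norm_pos_add [of "c * c + d * d" "2 *\<^sub>R (z * (- star z))"] norm_pos_scaleR [OF swap, of 2]
    by simp
  then have "m * (m * m) = 0" using norm_pos_antisym [OF m3] mbm by simp
  then have "(m * m) * (m * m) = 0" by (simp add: mult.assoc)
  then have "norm ((m * m) * (m * m)) = 0" by simp
  then have "m = 0" using m by (simp add: norm_selfadjoint_square star_mult)
  then show ?thesis using p by (simp add: m_def b_def)
qed

lemma norm_pos_conj:
  fixes c :: "'a::cstar_algebra"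
  assumes "norm_pos b"
  shows "norm_pos (c * b * star c)"
proof -
  obtain s where "norm_pos s" "s * s = b" using norm_pos_sqrt [OF assms] by metis
  then show ?thesis
    using norm_pos_star_mult [of "s * star c"] by (simp add: star_simps norm_pos_def mult.assoc)
qed

text \<open>Norm inequalities between all conjugates of two positive elements amount to an order
  inequality: conjugating by \<open>a = (t + \<delta>)\<^sup>-\<^sup>1\<^sup>/\<^sup>2\<close> turns \<open>t\<close> into an element of norm at most 1, so
  \<open>apa\<^sup>* \<le> c\<close>, and undoing the conjugation gives \<open>p \<le> c (t + \<delta>)\<close>.\<close>

lemma norm_pos_diff_if_conj_norms:
  fixes p t :: "'a::cstar_algebra"
  assumes p: "norm_pos p" and t: "norm_pos t" and c: "0 \<le> c"
    and le: "\<And>a. norm (a * p * star a) \<le> c * norm (a * t * star a)"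
  shows "norm_pos (c *\<^sub>R t - p)"
proof (rule norm_pos_limit)
  fix \<delta> :: real assume \<delta>: "0 < \<delta>"
  define b where "b = t + \<delta> *\<^sub>R 1"
  have b: "norm_pos b" using t \<delta> by (auto simp: b_def intro!: norm_pos_add norm_pos_scaleR)
  have "alg_invertible b" by (rule norm_pos_invertible [OF _ \<delta>]) (simp add: b_def t)
  then obtain d where d: "b * d = 1" "d * b = 1" by (auto simp: alg_invertible_def)
  have star_d: "star d = d"
    by (metis b d mult.assoc mult_1_left mult_1_right norm_pos_star star_mult star_one)
  obtain s where s: "norm_pos s" "s * s = b" "\<And>e. e * b = b * e \<Longrightarrow> e * s = s * e"
    using norm_pos_sqrt [OF b] by metis
  have ds: "d * s = s * d" using s(3) [of d] d by simp
  define a where "a = s * d"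
  have star_a: "star a = a" using norm_pos_star [OF s(1)] star_d by (simp add: a_def star_mult ds)
  have sa: "s * a = 1" using d by (simp add: a_def s(2) flip: mult.assoc)
  have as: "a * s = 1" using d by (simp add: a_def ds [symmetric] s(2) mult.assoc)
  have "a * b * a = 1" by (simp add: s(2) [symmetric] mult.assoc sa) (simp add: as flip: mult.assoc)
  then have ata: "1 - a * t * a = \<delta> *\<^sub>R (a * a)" by (simp add: b_def algebra_simps)
  have "norm (a * t * a) \<le> 1"
  proof (rule norm_pos_le_one)
    show "norm_pos (a * t * a)" using norm_pos_conj [OF t, of a] by (simp add: star_a)
    show "norm_pos (1 - a * t * a)"
      unfolding ata using \<delta> by (intro norm_pos_scaleR norm_pos_square star_a) simp
  qed
  then have "norm (a * p * a) \<le> c"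
    using le [of a] mult_left_mono [of "norm (a * t * a)" 1 c] c by (simp add: star_a)
  then have "norm_pos (c *\<^sub>R 1 - a * p * a)"
    using norm_pos_star [OF p] by (intro norm_pos_bound_minus) (simp_all add: star_mult star_a mult.assoc)
  from norm_pos_conj [OF this, of s]
  have "norm_pos (c *\<^sub>R (s * s) - (s * a) * p * (a * s))"
    using norm_pos_star [OF s(1)] by (simp add: algebra_simps)
  then show "norm_pos (c *\<^sub>R t - p + \<delta> *\<^sub>R (c *\<^sub>R 1))"
    by (simp add: sa as s(2) b_def algebra_simps)
qed

section \<open>Hilbert modules\<close>

context hilbert_module
begin

lemma ip_add_right: "ip H x (y + z) = ip H x y + ip H x z"
  by (metis ip_add_left ip_star star_add)

lemma ip_act_right: "ip H x (act H a y) = ip H x y * star a"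
  by (metis ip_act_left ip_star star_mult)

lemma ip_scaleR_left: "ip H (r *\<^sub>R x) y = r *\<^sub>R ip H x y"
  using ip_act_left [of "r *\<^sub>R 1" x y] by (simp add: act_scaleR)

lemma ip_scaleR_right: "ip H x (r *\<^sub>R y) = r *\<^sub>R ip H x y"
  by (metis ip_scaleR_left ip_star star_scaleR)

lemma ip_minus_left: "ip H (- x) y = - ip H x y"
  using ip_scaleR_left [of "-1" x y] by simp

lemma ip_minus_right: "ip H x (- y) = - ip H x y"
  using ip_scaleR_right [of x "-1" y] by simp

lemma ip_diff_left: "ip H (x - y) z = ip H x z - ip H y z"
  using ip_add_left [of x "- y" z] by (simp add: ip_minus_left)

lemma ip_diff_right: "ip H x (y - z) = ip H x y - ip H x z"
  using ip_add_right [of x y "- z"] by (simp add: ip_minus_right)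

lemma ip_zero_left [simp]: "ip H 0 y = 0"
  using ip_scaleR_left [of 0 0 y] by simp

lemma ip_zero_right [simp]: "ip H x 0 = 0"
  using ip_scaleR_right [of x 0 0] by simp

lemmas ip_linear = ip_add_left ip_add_right ip_diff_left ip_diff_right ip_minus_left ip_minus_right
  ip_scaleR_left ip_scaleR_right

lemma ip_ext:
  assumes "\<And>x. ip H x a = ip H x b"
  shows "a = b"
proof -
  have "ip H (a - b) (a - b) = 0" using assms [of "a - b"] by (simp add: ip_diff_right)
  then show ?thesis by (simp add: ip_eq_0)
qed

lemma norm_pos_ip: "norm_pos (ip H x x)"
  using ip_pos [of x] by (simp add: cstar_pos_iff_norm_pos)

lemma norm_ip_self: "norm (ip H x x) = (norm x)\<^sup>2"
  by (simp add: norm_eq)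

lemma act_minus: "act H a (- x) = - act H a x"
  using act_add_right [of a x "- x"] act_add_right [of a 0 0] by (simp add: add_eq_0_iff)

lemma act_diff: "act H a (x - y) = act H a x - act H a y"
  using act_add_right [of a x "- y"] by (simp add: act_minus)

lemma act_scaleR_right: "act H a (r *\<^sub>R x) = r *\<^sub>R act H a x"
  by (metis act_act act_scaleR mult.left_neutral mult.right_neutral mult_scaleR_left mult_scaleR_right)

lemma norm_act_le: "norm (act H a x) \<le> norm a * norm x"
proof -
  have "(norm (act H a x))\<^sup>2 = norm (a * ip H x x * star a)"
    by (simp add: norm_ip_self [symmetric] ip_act_left ip_act_right mult.assoc)
  also have "\<dots> \<le> norm a * norm (ip H x x) * norm (star a)"
    by (intro norm_mult_ineq [THEN order_trans] mult_right_mono) auto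
  also have "\<dots> = (norm a * norm x)\<^sup>2" by (simp add: norm_ip_self power2_eq_square)
  finally show ?thesis by (simp add: power2_le_iff_abs_le)
qed

lemma bounded_linear_act: "bounded_linear (act H a)"
  by (rule bounded_linear_intro [where K = "norm a"])
    (simp_all add: act_add_right act_scaleR_right norm_act_le mult.commute)

abbreviation im_times :: "'h \<Rightarrow> 'h" where
  "im_times \<equiv> act H (\<i> *\<^sub>C 1)"

lemma ip_im_left: "ip H (im_times x) y = \<i> *\<^sub>C ip H x y"
  by (simp add: ip_act_left mult_scaleC_left)

lemma ip_im_right: "ip H x (im_times y) = - (\<i> *\<^sub>C ip H x y)"
  by (simp add: ip_act_right star_scaleC scaleC_minus_left mult_scaleC_right)

lemma bounded_bilinear_ip: "bounded_bilinear (ip H)"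
proof
  \<comment> \<open>Polarisation in the four directions \<open>\<plusminus>y\<close>, \<open>\<plusminus>\<i>y\<close>; the bound becomes bilinear by rescaling to unit vectors.\<close>
  have crude: "norm (ip H x y) \<le> (norm x + norm y)\<^sup>2" for x y
  proof -
    have bnd: "norm (ip H (x + z) (x + z)) \<le> (norm x + norm y)\<^sup>2" if "norm z \<le> norm y" for z
      unfolding norm_ip_self using that norm_triangle_ineq [of x z] by (intro power_mono) auto
    have im: "norm (im_times y) \<le> norm y"
      using norm_act_le [of "\<i> *\<^sub>C 1" y] by (simp add: norm_scaleC)
    let ?q = "\<lambda>z. ip H (x + z) (x + z)"
    have "4 *\<^sub>R ip H x y = (?q y - ?q (- y)) + \<i> *\<^sub>C (?q (im_times y) - ?q (- im_times y))"
      using scaleR_add_left [of 2 2 "ip H x y"]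
      by (simp add: ip_linear ip_im_left ip_im_right scaleC_simps scaleR_2 algebra_simps)
    also have "norm \<dots> \<le> (norm (?q y) + norm (?q (- y))) +
        (norm (?q (im_times y)) + norm (?q (- im_times y)))"
      by (intro norm_triangle_le add_mono norm_triangle_ineq4)
        (simp add: norm_scaleC norm_triangle_ineq4)
    also have "\<dots> \<le> 4 * (norm x + norm y)\<^sup>2"
      using bnd [of y] bnd [of "- y"] bnd [of "im_times y"] bnd [of "- im_times y"] im by simp
    finally show ?thesis by simp
  qed
  show "\<exists>K. \<forall>a b. norm (ip H a b) \<le> norm a * norm b * K"
  proof (intro exI [of _ 4] allI)
    fix a b
    show "norm (ip H a b) \<le> norm a * norm b * 4"
    proof (cases "a = 0 \<or> b = 0")
      case False
      then show ?thesis
        using crude [of "(1 / norm a) *\<^sub>R a" "(1 / norm b) *\<^sub>R b"]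
        by (simp add: ip_linear field_simps)
    qed auto
  qed
qed (simp_all add: ip_linear)

definition selfadjoint :: "('h \<Rightarrow> 'h) \<Rightarrow> bool" where
  "selfadjoint T \<longleftrightarrow> (\<forall>x y. ip H (T x) y = ip H x (T y))"

lemma selfadjoint_scaleR: "selfadjoint T \<Longrightarrow> T (r *\<^sub>R x) = r *\<^sub>R T x"
  by (rule ip_ext) (metis selfadjoint_def ip_scaleR_right)

lemma selfadjoint_diff: "selfadjoint T \<Longrightarrow> T (x - y) = T x - T y"
  by (rule ip_ext) (metis selfadjoint_def ip_diff_right)

lemma module_linear_additive: "module_linear H H T \<Longrightarrow> T (x + y) = T x + T y"
  by (simp add: module_linear_def)

lemma module_linear_act: "module_linear H H T \<Longrightarrow> T (act H a x) = act H a (T x)"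
  by (simp add: module_linear_def)

lemma module_linear_scaleR: "module_linear H H T \<Longrightarrow> T (r *\<^sub>R x) = r *\<^sub>R T x"
  by (metis module_linear_act act_scaleR)

lemma module_linear_diff: "module_linear H H T \<Longrightarrow> T (x - y) = T x - T y"
  using module_linear_additive [of T x "- y"] module_linear_scaleR [of T "-1" y] by simp

subsection \<open>Positive operators\<close>

lemma pos_op_norm_pos: "pos_op H T \<Longrightarrow> norm_pos (ip H (T x) x)"
  by (simp add: pos_op_def cstar_pos_iff_norm_pos)

text \<open>Polarisation: the quadratic form takes self-adjoint values, at \<open>x + y\<close> and at \<open>x + \<i>y\<close>.\<close>

lemma pos_op_selfadjoint:
  assumes T: "pos_op H T"
  shows "selfadjoint T"
  unfolding selfadjoint_def
proof (intro allI)
  fix x y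
  have lin: "module_linear H H T" using T by (simp add: pos_op_def)
  note T_simps = module_linear_additive [OF lin] module_linear_act [OF lin]
  have sym: "ip H (T z) z = ip H z (T z)" for z
    using norm_pos_star [OF pos_op_norm_pos [OF T]] by (metis ip_star)
  have re: "ip H (T x) w + ip H (T w) x = ip H x (T w) + ip H w (T x)" for w
    using sym [of "x + w"] sym [of x] sym [of w] by (simp add: T_simps ip_linear add.commute)
  have "\<i> *\<^sub>C (ip H (T y) x - ip H (T x) y) = \<i> *\<^sub>C (ip H y (T x) - ip H x (T y))"
    using re [of "im_times y"] by (simp add: T_simps ip_im_left ip_im_right scaleC_diff_right)
  then have "\<i> *\<^sub>C \<i> *\<^sub>C (ip H (T y) x - ip H (T x) y) = \<i> *\<^sub>C \<i> *\<^sub>C (ip H y (T x) - ip H x (T y))"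
    by simp
  then have "ip H (T y) x - ip H (T x) y = ip H y (T x) - ip H x (T y)"
    unfolding scaleC_ii_ii by (simp only: neg_equal_iff_equal)
  with re [of y] have "(ip H (T x) y + ip H (T y) x) - (ip H (T y) x - ip H (T x) y) =
      (ip H x (T y) + ip H y (T x)) - (ip H y (T x) - ip H x (T y))" by simp
  then have "2 *\<^sub>R ip H (T x) y = 2 *\<^sub>R ip H x (T y)" by (simp add: scaleR_2)
  then show "ip H (T x) y = ip H x (T y)" by simp
qed

text \<open>The bicommutant of \<open>T\<close> relative to maps that satisfy \<open>\<langle>S x, y\<rangle> = \<langle>x, S y\<rangle>\<close>.  No continuity is
  asked of \<open>S\<close>: the operators \<open>P\<^sub>W T\<^sup>* T P\<^sub>W\<close> are given algebraically, and moving \<open>S\<close> to the other side of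
  the inner product replaces their continuity by that of the inner product.\<close>

definition bicommutant :: "('h \<Rightarrow> 'h) \<Rightarrow> ('h \<Rightarrow> 'h) set" where
  "bicommutant T = {R. \<forall>S. selfadjoint S \<longrightarrow> (\<forall>g. S (T g) = T (S g)) \<longrightarrow> (\<forall>f. S (R f) = R (S f))}"

lemma bicommutantD:
  assumes "R \<in> bicommutant T" "selfadjoint S" "\<And>g. S (T g) = T (S g)"
  shows "S (R f) = R (S f)"
  using assms by (simp add: bicommutant_def)

lemma sqrt_id_minus_op:
  assumes lin: "module_linear H H X" and contr: "\<And>f. norm (X f) \<le> norm f" and sa: "selfadjoint X"
  obtains R where "bounded_linear R" "module_linear H H R" "selfadjoint R"
    "\<And>f. R (R f) = f - X f" "\<And>f. norm (f - R f) \<le> norm f"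
    "R \<in> bicommutant X"
proof
  interpret contraction X
    by unfold_locales (simp_all add: module_linear_additive [OF lin] module_linear_scaleR [OF lin] contr)
  interpret ip: bounded_bilinear "ip H" by (rule bounded_bilinear_ip)
  let ?R = "sqrt_id_minus X"
  show "bounded_linear ?R" by (rule bounded_linear_sqrt)
  have pow_act: "(X ^^ n) (act H a x) = act H a ((X ^^ n) x)" for n a x
    by (induction n) (simp_all add: module_linear_act [OF lin])
  have "?R (x + y) = ?R x + ?R y" for x y
    using bounded_linear_sqrt by (simp add: linear_simps)
  moreover have "?R (act H a x) = act H a (?R x)" for a x
    by (rule sqrt_intertwine [OF bounded_linear_ident bounded_linear_act]) (simp add: pow_act)
  ultimately show "module_linear H H ?R" by (simp add: module_linear_def)
  have pow_sa: "ip H ((X ^^ n) x) y = ip H x ((X ^^ n) y)" for n x y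
    by (induction n arbitrary: x y)
      (simp_all add: sa [unfolded selfadjoint_def] funpow_swap1)
  show R_sa: "selfadjoint ?R"
    unfolding selfadjoint_def
    by (intro allI sqrt_intertwine [OF ip.bounded_linear_left ip.bounded_linear_right])
      (simp add: pow_sa)
  show "?R (?R f) = f - X f" for f by (rule sqrt_squared)
  show "norm (f - ?R f) \<le> norm f" for f by (rule norm_diff_sqrt_le)
  have "S (?R f) = ?R (S f)" if S: "selfadjoint S" and comm: "\<And>g. S (X g) = X (S g)" for S f
  proof (rule ip_ext)
    have pow_S: "S ((X ^^ n) g) = (X ^^ n) (S g)" for n g
      by (induction n) (simp_all add: comm)
    fix a
    have "ip H (S a) (?R f) = ip H a (?R (S f))"
      by (rule sqrt_intertwine [OF ip.bounded_linear_right ip.bounded_linear_right])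
        (use S in \<open>simp add: selfadjoint_def pow_S\<close>)
    then show "ip H a (S (?R f)) = ip H a (?R (S f))" using S by (simp add: selfadjoint_def)
  qed
  then show "?R \<in> bicommutant X" by (auto simp: bicommutant_def)
qed

text \<open>As \<open>1 - X = R\<^sup>2\<close> with \<open>R\<close> self-adjoint, \<open>\<langle>(1 - X) f, f\<rangle> = \<langle>R f, R f\<rangle>\<close>.\<close>

lemma norm_pos_id_minus_contraction:
  assumes "module_linear H H X" and "\<And>f. norm (X f) \<le> norm f" and "selfadjoint X"
  shows "norm_pos (ip H (f - X f) f)"
proof -
  obtain R where "selfadjoint R" "\<And>f. R (R f) = f - X f"
    using sqrt_id_minus_op [OF assms] by metis
  then have "ip H (f - X f) f = ip H (R f) (R f)" by (metis selfadjoint_def)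
  then show ?thesis by (simp add: norm_pos_ip)
qed

lemma selfadjoint_id_minus: "selfadjoint X \<Longrightarrow> selfadjoint (\<lambda>f. f - X f)"
  by (simp add: selfadjoint_def ip_linear)

lemma module_linear_id_minus: "module_linear H H X \<Longrightarrow> module_linear H H (\<lambda>f. f - X f)"
  by (simp add: module_linear_def act_diff)

text \<open>With \<open>Z = 1 - T\<close>, \<open>\<langle>Z f, Z f\<rangle> = \<langle>f, f\<rangle> - \<langle>T f, f\<rangle> - \<langle>Z f, T f\<rangle>\<close>, and both subtracted terms are
  positive, the last one because \<open>Z\<close> is the square of a self-adjoint operator that commutes with \<open>T\<close>.\<close>

lemma norm_id_minus_pos_contraction:
  assumes lin: "module_linear H H T" and contr: "\<And>f. norm (T f) \<le> norm f" and sa: "selfadjoint T"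
    and pos: "\<And>f. norm_pos (ip H (T f) f)"
  shows "norm (f - T f) \<le> norm f"
proof -
  obtain R where R: "selfadjoint R" "\<And>f. R (R f) = f - T f"
    "R \<in> bicommutant T"
    using sqrt_id_minus_op [OF lin contr sa] by metis
  define z where "z = f - T f"
  have "ip H z (T f) = ip H (R (R f)) (T f)" by (simp add: z_def R(2))
  also have "\<dots> = ip H (R f) (T (R f))" using R(1) bicommutantD [OF R(3) sa] by (simp add: selfadjoint_def)
  also have "\<dots> = ip H (T (R f)) (R f)" using sa by (simp add: selfadjoint_def)
  finally have "norm_pos (ip H z (T f))" using pos by simp
  then have "norm_pos (ip H z (T f) + ip H (T f) f)" using pos by (rule norm_pos_add)
  moreover have "ip H f f = ip H z z + (ip H z (T f) + ip H (T f) f)"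
    by (simp add: z_def ip_linear)
  ultimately have "norm (ip H z z) \<le> norm (ip H f f)"
    using norm_pos_mono [OF norm_pos_ip] by metis
  then show ?thesis by (simp add: norm_ip_self z_def power2_le_iff_abs_le)
qed

text \<open>Scaled to a contraction, \<open>T\<close> is \<open>1 - X\<close> with \<open>X\<close> a contraction too, so the series
  applies to \<open>X\<close>; the resulting root \<open>R\<close> is positive since \<open>1 - R\<close> is again a contraction.\<close>

lemma pos_op_sqrt_exists:
  assumes T: "pos_op H T"
  obtains R where "pos_op H R" "\<And>f. R (R f) = T f"
    "R \<in> bicommutant T"
proof -
  have lin: "module_linear H H T" and bl: "bounded_linear T" using T by (auto simp: pos_op_def)
  obtain M where M: "M > 0" "\<And>f. norm (T f) \<le> norm f * M"
    using bounded_linear.pos_bounded [OF bl] by metis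
  define T1 where "T1 = (\<lambda>f. (1 / M) *\<^sub>R T f)"
  have lin1: "module_linear H H T1"
    using lin by (simp add: T1_def module_linear_def scaleR_add_right act_scaleR_right)
  have sa1: "selfadjoint T1"
    using pos_op_selfadjoint [OF T] by (simp add: T1_def selfadjoint_def ip_linear)
  have contr1: "norm (T1 f) \<le> norm f" for f
    using M(1) M(2) [of f] by (simp add: T1_def field_simps)
  have pos1: "norm_pos (ip H (T1 f) f)" for f
    using M(1) pos_op_norm_pos [OF T] by (simp add: T1_def ip_linear norm_pos_scaleR)
  define X where "X = (\<lambda>f. f - T1 f)"
  have X: "module_linear H H X" "norm (X f) \<le> norm f" "selfadjoint X" for f
    unfolding X_def
    by (rule module_linear_id_minus [OF lin1] norm_id_minus_pos_contraction [OF lin1 contr1 sa1 pos1]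
        selfadjoint_id_minus [OF sa1])+
  obtain R where R: "bounded_linear R" "module_linear H H R" "selfadjoint R"
    "\<And>f. R (R f) = f - X f" "\<And>f. norm (f - R f) \<le> norm f"
    "R \<in> bicommutant X"
    by (rule sqrt_id_minus_op [OF X]) (rule that)
  have "norm_pos (ip H (f - (f - R f)) f)" for f
    by (rule norm_pos_id_minus_contraction
        [OF module_linear_id_minus [OF R(2)] R(5) selfadjoint_id_minus [OF R(3)]])
  then have Rpos: "norm_pos (ip H (R f) f)" for f by simp
  show ?thesis
  proof
    let ?R = "\<lambda>f. sqrt M *\<^sub>R R f"
    have "bounded_linear ?R"
      by (rule bounded_linear_compose [OF bounded_linear_scaleR_right R(1)])
    moreover have "module_linear H H ?R"
      using R(2) by (simp add: module_linear_def scaleR_add_right act_scaleR_right)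
    ultimately show "pos_op H ?R"
      using M(1) Rpos by (simp add: pos_op_def cstar_pos_iff_norm_pos ip_linear norm_pos_scaleR)
    show "?R (?R f) = T f" for f
      using M(1) by (simp add: module_linear_scaleR [OF R(2)] R(4) X_def T1_def)
    have "S (?R f) = ?R (S f)" if S: "selfadjoint S" and comm: "\<And>g. S (T g) = T (S g)" for S f
    proof -
      have "S (R f) = R (S f)"
        by (rule bicommutantD [OF R(6) S])
          (simp add: X_def T1_def selfadjoint_diff [OF S] selfadjoint_scaleR [OF S] comm)
      then show ?thesis by (simp add: selfadjoint_scaleR [OF S])
    qed
    then show "?R \<in> bicommutant T" by (auto simp: bicommutant_def)
  qed
qed

lemma pos_op_kernel:
  assumes "pos_op H T" and zero: "ip H (T d) d = 0"
  shows "T d = 0"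
proof -
  obtain R where R: "pos_op H R" "\<And>f. R (R f) = T f"
    using pos_op_sqrt_exists [OF assms(1)] by metis
  have "ip H (R d) (R d) = ip H (R (R d)) d"
    using pos_op_selfadjoint [OF R(1)] by (simp add: selfadjoint_def)
  then have "R d = 0" using zero by (simp add: R(2) ip_eq_0)
  then have "T d = R 0" by (simp flip: R(2))
  also have "\<dots> = 0"
    using R(1) bounded_linear.linear [THEN linear_0] by (auto simp: pos_op_def)
  finally show ?thesis .
qed

text \<open>Both roots commute, so \<open>d = Q f - R f\<close> satisfies \<open>(Q + R) d = 0\<close>.  By positivity \<open>Q d = R d = 0\<close>,
  and then \<open>\<langle>d, d\<rangle> = \<langle>f, (Q - R) d\<rangle> = 0\<close>.\<close>

lemma pos_op_sqrt_unique:
  assumes Q: "pos_op H Q" "\<And>f. Q (Q f) = T f" "Q \<in> bicommutant T"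
    and R: "pos_op H R" "\<And>f. R (R f) = T f"
  shows "R = Q"
proof
  fix f
  have Qsa: "selfadjoint Q" and Rsa: "selfadjoint R"
    using Q(1) R(1) by (auto intro: pos_op_selfadjoint)
  have Qlin: "module_linear H H Q" and Rlin: "module_linear H H R"
    using Q(1) R(1) by (auto simp: pos_op_def)
  have comm: "R (Q g) = Q (R g)" for g
    by (rule bicommutantD [OF Q(3) Rsa]) (simp flip: R(2))
  define d where "d = Q f - R f"
  have "Q d + R d = 0"
    by (simp add: d_def module_linear_diff [OF Qlin] module_linear_diff [OF Rlin] comm Q(2) R(2))
  then have "ip H (Q d) d = - ip H (R d) d"
    by (simp add: add_eq_0_iff2 ip_minus_left)
  then have "ip H (R d) d = 0" and "ip H (Q d) d = 0"
    using norm_pos_antisym [OF pos_op_norm_pos [OF R(1), of d]] pos_op_norm_pos [OF Q(1), of d] by simp_all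
  then have "R d = 0" and "Q d = 0"
    using pos_op_kernel [OF R(1)] pos_op_kernel [OF Q(1)] by auto
  moreover have "ip H d d = ip H (Q f) d - ip H (R f) d"
    by (simp add: ip_diff_left [symmetric] d_def)
  moreover have "\<dots> = ip H f (Q d) - ip H f (R d)"
    using Qsa Rsa by (simp add: selfadjoint_def)
  ultimately show "R f = Q f" by (simp add: ip_eq_0 d_def)
qed

lemma op_sqrt:
  assumes T: "pos_op H T"
  shows pos_op_op_sqrt: "pos_op H (op_sqrt H T)"
    and op_sqrt_op_sqrt: "op_sqrt H T (op_sqrt H T f) = T f"
    and op_sqrt_bicommutant: "op_sqrt H T \<in> bicommutant T"
proof -
  obtain Q where Q: "pos_op H Q" "\<And>f. Q (Q f) = T f" "Q \<in> bicommutant T"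
    using pos_op_sqrt_exists [OF T] by metis
  have "op_sqrt H T = Q"
    unfolding op_sqrt_def
  proof (rule the_equality)
    show "pos_op H Q \<and> Q \<circ> Q = T" using Q by auto
    show "R = Q" if "pos_op H R \<and> R \<circ> R = T" for R
      using that by (intro pos_op_sqrt_unique [OF Q]) auto
  qed
  then show "pos_op H (op_sqrt H T)" "op_sqrt H T (op_sqrt H T f) = T f" "op_sqrt H T \<in> bicommutant T"
    using Q by auto
qed

text \<open>For the positive root \<open>R\<close> of \<open>C\<close>, which commutes with \<open>C'\<close>, \<open>\<langle>C C' f, f\<rangle> = \<langle>C' R f, R f\<rangle>\<close>.\<close>

lemma pos_op_comp:
  assumes C: "pos_op H C" and C': "pos_op H C'" and comm: "C \<circ> C' = C' \<circ> C"
  shows "pos_op H (C \<circ> C')"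
proof -
  obtain R where R: "pos_op H R" "\<And>f. R (R f) = C f" "R \<in> bicommutant C"
    using pos_op_sqrt_exists [OF C] by metis
  have RC': "C' (R f) = R (C' f)" for f
    by (rule bicommutantD [OF R(3) pos_op_selfadjoint [OF C']]) (metis comm comp_apply)
  have "ip H (C (C' f)) f = ip H (C' (R f)) (R f)" for f
    using pos_op_selfadjoint [OF R(1)] by (simp add: RC' selfadjoint_def flip: R(2))
  then have "norm_pos (ip H ((C \<circ> C') f) f)" for f using pos_op_norm_pos [OF C'] by simp
  moreover have "bounded_linear (C \<circ> C')"
    using C C' by (auto simp: pos_op_def o_def intro: bounded_linear_compose)
  moreover have "module_linear H H (C \<circ> C')"
    using C C' by (simp add: pos_op_def module_linear_def)
  ultimately show ?thesis by (simp add: pos_op_def cstar_pos_iff_norm_pos)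
qed

subsection \<open>Projections\<close>

context
  fixes W assumes W: "complemented_submodule H W"
begin

lemma complemented_minus: "x \<in> W \<Longrightarrow> y \<in> W \<Longrightarrow> x - y \<in> W"
  using W act_scaleR [of "-1" y] unfolding complemented_submodule_def submodule_def
  by (metis diff_conv_add_uminus scaleR_minus1_left)

lemma proj_ex1: "\<exists>!w. w \<in> W \<and> x - w \<in> orth_compl H W"
proof -
  obtain w z where wz: "w \<in> W" "z \<in> orth_compl H W" "x = w + z"
    using W unfolding complemented_submodule_def by metis
  show ?thesis
  proof (rule ex1I [of _ w])
    show "w \<in> W \<and> x - w \<in> orth_compl H W" using wz by simp
    fix w' assume w': "w' \<in> W \<and> x - w' \<in> orth_compl H W"
    then have "w' - w \<in> W" using wz complemented_minus by blast
    then have "ip H z (w' - w) = 0" and "ip H (x - w') (w' - w) = 0"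
      using wz w' by (auto simp: orth_compl_def)
    then have "ip H (z - (x - w')) (w' - w) = 0" by (simp only: ip_diff_left diff_self)
    moreover have "z - (x - w') = w' - w" using wz by simp
    ultimately show "w' = w" by (simp add: ip_eq_0)
  qed
qed

lemma proj_in: "proj H W x \<in> W" and diff_proj: "x - proj H W x \<in> orth_compl H W"
  using theI' [OF proj_ex1, of x] by (simp_all add: proj_def)

lemma proj_eqI: "w \<in> W \<Longrightarrow> x - w \<in> orth_compl H W \<Longrightarrow> proj H W x = w"
  unfolding proj_def using the1_equality [OF proj_ex1] by blast

lemma proj_selfadjoint: "selfadjoint (proj H W)"
  unfolding selfadjoint_def
proof (intro allI)
  fix x y
  have orth: "ip H (a - proj H W a) (proj H W b) = 0" for a b
    using diff_proj [of a] proj_in [of b] by (simp add: orth_compl_def)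
  have "ip H (proj H W x) y = star (ip H y (proj H W x))" by (simp add: ip_star)
  also have "\<dots> = star (ip H (proj H W y) (proj H W x))" using orth [of y x] by (simp add: ip_diff_left)
  also have "\<dots> = ip H (proj H W x) (proj H W y)" by (simp add: ip_star)
  also have "\<dots> = ip H x (proj H W y)" using orth [of x y] by (simp add: ip_diff_left)
  finally show "ip H (proj H W x) y = ip H x (proj H W y)" .
qed

lemma proj_act: "proj H W (act H a x) = act H a (proj H W x)"
proof (rule proj_eqI)
  show "act H a (proj H W x) \<in> W"
    using W proj_in by (simp add: complemented_submodule_def submodule_def)
  show "act H a x - act H a (proj H W x) \<in> orth_compl H W"
    using diff_proj [of x] by (simp add: orth_compl_def ip_act_left flip: act_diff)
qed

end

end

lemma ip_adj:
  assumes H: "hilbert_module H" and T: "T \<in> adjointable H L S" and y: "y \<in> S"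
  shows "ip L (T x) y = ip H x (adj H L T y)"
proof -
  interpret hilbert_module H by fact
  obtain T' where T': "\<And>x y. y \<in> S \<Longrightarrow> ip L (T x) y = ip H x (T' y)"
    using T unfolding adjointable_def by blast
  have "adj H L T y = T' y"
    unfolding adj_def by (rule the_equality) (use T' y in \<open>auto intro!: ip_ext\<close>)
  then show ?thesis using T' y by simp
qed

section \<open>The frame operator summands\<close>

lemma
  assumes H: "hilbert_module H" and L: "hilbert_module L" and W: "complemented_submodule H W"
    and T: "T \<in> adjointable H L S"
  shows ip_sandwich: "ip L (T (proj H W x)) (T (proj H W y)) = ip H x (sandwich H L W T y)"
    and selfadjoint_sandwich: "hilbert_module.selfadjoint H (sandwich H L W T)"
proof -
  interpret H: hilbert_module H by fact
  interpret L: hilbert_module L by fact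
  have T_in: "T z \<in> S" for z using T by (auto simp: adjointable_def)
  have main: "ip L (T (proj H W x)) (T (proj H W y)) = ip H x (sandwich H L W T y)" for x y
    using ip_adj [OF H T T_in] H.proj_selfadjoint [OF W]
    by (simp add: sandwich_def H.selfadjoint_def)
  then show "ip L (T (proj H W x)) (T (proj H W y)) = ip H x (sandwich H L W T y)" .
  show "H.selfadjoint (sandwich H L W T)"
    unfolding H.selfadjoint_def by (metis main H.ip_star L.ip_star)
qed

text \<open>\<open>C\<close>, \<open>C'\<close> and the root of \<open>C C'\<close> are self-adjoint and commute with \<open>P\<^sub>W T\<^sup>* T P\<^sub>W\<close>, so they can be moved
  between the two arguments; the weight, central and self-adjoint, splits as \<open>v\<^sup>2 z = v z v\<^sup>*\<close>.\<close>

lemma controlled_summand: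
  fixes f :: "'h::banach"
  assumes H: "hilbert_module H" and L: "hilbert_module L" and W: "complemented_submodule H W"
    and T: "T \<in> adjointable H L S" and v: "weight v"
    and C: "pos_op H C" and C': "pos_op H C'" and CC': "C \<circ> C' = C' \<circ> C"
    and comm: "C \<circ> sandwich H L W T = sandwich H L W T \<circ> C"
    and comm': "C' \<circ> sandwich H L W T = sandwich H L W T \<circ> C'"
  defines "g \<equiv> op_sqrt H (C \<circ> C') f"
  shows "v\<^sup>2 * ip L (T (proj H W (C f))) (T (proj H W (C' f))) =
    ip L (act L v (T (proj H W g))) (act L v (T (proj H W g)))"
proof -
  interpret H: hilbert_module H by fact
  interpret L: hilbert_module L by fact
  let ?S = "sandwich H L W T" and ?R = "op_sqrt H (C \<circ> C')"
  note S_sa = selfadjoint_sandwich [OF H L W T]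
  have CC'_pos: "pos_op H (C \<circ> C')" by (rule H.pos_op_comp [OF C C' CC'])
  have R_sa: "H.selfadjoint ?R" by (rule H.pos_op_selfadjoint [OF H.pos_op_op_sqrt [OF CC'_pos]])
  have C_sa: "H.selfadjoint C" by (rule H.pos_op_selfadjoint [OF C])
  have CS: "C (?S x) = ?S (C x)" and C'S: "C' (?S x) = ?S (C' x)" for x
    using comm comm' by (metis comp_apply)+
  have SR: "?S (?R x) = ?R (?S x)" for x
    by (rule H.bicommutantD [OF H.op_sqrt_bicommutant [OF CC'_pos] S_sa]) (simp add: CS C'S)
  have "ip L (T (proj H W (C f))) (T (proj H W (C' f))) = ip H (C f) (?S (C' f))"
    by (rule ip_sandwich [OF H L W T])
  also have "\<dots> = ip H f (?S ((C \<circ> C') f))" using C_sa by (simp add: H.selfadjoint_def CS)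
  also have "\<dots> = ip H f (?S (?R (?R f)))" by (simp only: H.op_sqrt_op_sqrt [OF CC'_pos])
  also have "\<dots> = ip H (?R f) (?S (?R f))" using R_sa SR by (simp add: H.selfadjoint_def)
  also have "\<dots> = ip L (T (proj H W g)) (T (proj H W g))"
    unfolding g_def by (rule ip_sandwich [OF H L W T, symmetric])
  finally have eq: "ip L (T (proj H W (C f))) (T (proj H W (C' f))) = ip L (T (proj H W g)) (T (proj H W g))" .
  have v2: "v\<^sup>2 * z = v * (z * star v)" for z
    using v by (metis weight_def cstar_pos_def power2_eq_square mult.assoc)
  show ?thesis by (simp only: eq v2 L.ip_act_left L.ip_act_right mult.assoc)
qed

section \<open>The norm of square summable sequences\<close>

context hilbert_module
begin

lemma has_sum_ip_norm_pos:
  "((\<lambda>j. ip H (x j) (x j)) has_sum S) J \<Longrightarrow> norm_pos S"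
  by (erule norm_pos_has_sum) (rule norm_pos_ip)

lemma l2_norm_minus: "l2_norm H J (\<lambda>j. - x j) = l2_norm H J x"
  by (simp add: l2_norm_def ip_linear)

text \<open>Termwise \<open>\<langle>x + y, x + y\<rangle> \<le> (1 + t)\<langle>x, x\<rangle> + (1 + 1/t)\<langle>y, y\<rangle>\<close> for every \<open>t > 0\<close>, because the difference
  is the square of \<open>\<surd>t x - y/\<surd>t\<close>.  This survives summation, and \<open>t = \<parallel>y\<parallel>/\<parallel>x\<parallel>\<close> gives
  \<open>(\<parallel>x\<parallel> + \<parallel>y\<parallel>)\<^sup>2\<close> on the right.\<close>

lemma l2_norm_triangle:
  assumes x: "(\<lambda>j. ip H (x j) (x j)) summable_on J" and y: "(\<lambda>j. ip H (y j) (y j)) summable_on J"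
    and xy: "(\<lambda>j. ip H (x j + y j) (x j + y j)) summable_on J"
  shows "l2_norm H J (\<lambda>j. x j + y j) \<le> l2_norm H J x + l2_norm H J y"
proof (rule field_le_epsilon)
  fix e :: real assume e: "e > 0"
  define X Y Z where "X = (\<Sum>\<^sub>\<infinity>j\<in>J. ip H (x j) (x j))" and "Y = (\<Sum>\<^sub>\<infinity>j\<in>J. ip H (y j) (y j))"
    and "Z = (\<Sum>\<^sub>\<infinity>j\<in>J. ip H (x j + y j) (x j + y j))"
  have X: "((\<lambda>j. ip H (x j) (x j)) has_sum X) J" and Y: "((\<lambda>j. ip H (y j) (y j)) has_sum Y) J"
    and Z: "((\<lambda>j. ip H (x j + y j) (x j + y j)) has_sum Z) J"
    using x y xy by (simp_all add: X_def Y_def Z_def)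
  \<comment> \<open>The two norms are enlarged to make the quotient \<open>t = b / a\<close> defined and positive.\<close>
  define a b where "a = sqrt (norm X) + e / 2" and "b = sqrt (norm Y) + e / 2"
  have ab: "a > 0" "b > 0" "norm X \<le> a\<^sup>2" "norm Y \<le> b\<^sup>2"
    using e real_sqrt_ge_zero [of "norm X"] real_sqrt_ge_zero [of "norm Y"]
    by (auto simp: a_def b_def add_nonneg_pos power2_sum)
  define t where "t = b / a"
  have t: "t > 0" using ab by (simp add: t_def)
  have "((\<lambda>j. (1 + t) *\<^sub>R ip H (x j) (x j) + (1 + 1 / t) *\<^sub>R ip H (y j) (y j)
      + (-1) *\<^sub>R ip H (x j + y j) (x j + y j)) has_sum
      ((1 + t) *\<^sub>R X + (1 + 1 / t) *\<^sub>R Y + (-1) *\<^sub>R Z)) J"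
    by (intro has_sum_add has_sum_scaleR X Y Z)
  moreover have "(1 + t) *\<^sub>R ip H (x j) (x j) + (1 + 1 / t) *\<^sub>R ip H (y j) (y j)
      + (-1) *\<^sub>R ip H (x j + y j) (x j + y j) =
      ip H (sqrt t *\<^sub>R x j - (1 / sqrt t) *\<^sub>R y j) (sqrt t *\<^sub>R x j - (1 / sqrt t) *\<^sub>R y j)" for j
    using t by (simp add: ip_linear scaleR_add_left algebra_simps)
  ultimately have "norm_pos ((1 + t) *\<^sub>R X + (1 + 1 / t) *\<^sub>R Y + (-1) *\<^sub>R Z)"
    by (auto intro: has_sum_ip_norm_pos)
  then have "norm Z \<le> norm ((1 + t) *\<^sub>R X + (1 + 1 / t) *\<^sub>R Y)"
    using norm_pos_mono [OF has_sum_ip_norm_pos [OF Z]] by fastforce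
  also have "\<dots> \<le> (1 + t) * norm X + (1 + 1 / t) * norm Y"
    using t by (intro norm_triangle_le) simp
  also have "\<dots> \<le> (1 + t) * a\<^sup>2 + (1 + 1 / t) * b\<^sup>2"
    using ab t by (intro add_mono mult_left_mono) auto
  also have "\<dots> = (a + b)\<^sup>2"
    using ab by (simp add: t_def field_simps power2_eq_square)
  finally have "sqrt (norm Z) \<le> a + b"
    using ab by (intro real_le_lsqrt) auto
  then show "l2_norm H J (\<lambda>j. x j + y j) \<le> l2_norm H J x + l2_norm H J y + e"
    by (simp add: l2_norm_def a_def b_def X_def Y_def Z_def)
qed

end

section \<open>Stability of controlled frames under perturbation\<close>

theorem theorem5p1:
  fixes H :: "('a::cstar_algebra, 'h::banach) hmod"
    and L :: "('a, 'l::banach) hmod"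
    and J :: "'j set"
    and Hs :: "'j \<Rightarrow> 'l set"
    and K C C' :: "'h \<Rightarrow> 'h"
    and W V :: "'j \<Rightarrow> 'h set"
    and \<Lambda> \<Gamma> :: "'j \<Rightarrow> 'h \<Rightarrow> 'l"
    and v u :: "'j \<Rightarrow> 'a"
    and A B lam1 lam2 \<epsilon> :: real
  assumes "hilbert_module H" and "countably_generated H"
    and "hilbert_module L" and "countably_generated L"
    and "countable J"
    and "\<And>j. j \<in> J \<Longrightarrow> submodule L (Hs j)"
    and "K \<in> adjointable H H UNIV"
    and "C \<in> GL_pos H" and "C' \<in> GL_pos H"
    and "controlled_frame_bounds H L J Hs C C' K W \<Lambda> v A B"
    and "\<And>j. j \<in> J \<Longrightarrow> \<Gamma> j \<in> adjointable H L (Hs j)"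
    and "\<And>j. j \<in> J \<Longrightarrow> complemented_submodule H (V j)"
    and "\<And>j. j \<in> J \<Longrightarrow> weight (u j)"
    and "C \<circ> C' = C' \<circ> C"
    and "\<And>j. j \<in> J \<Longrightarrow> C \<circ> sandwich H L (W j) (\<Lambda> j) = sandwich H L (W j) (\<Lambda> j) \<circ> C"
    and "\<And>j. j \<in> J \<Longrightarrow> C' \<circ> sandwich H L (W j) (\<Lambda> j) = sandwich H L (W j) (\<Lambda> j) \<circ> C'"
    and "\<And>j. j \<in> J \<Longrightarrow> C \<circ> sandwich H L (V j) (\<Gamma> j) = sandwich H L (V j) (\<Gamma> j) \<circ> C"
    and "\<And>j. j \<in> J \<Longrightarrow> C' \<circ> sandwich H L (V j) (\<Gamma> j) = sandwich H L (V j) (\<Gamma> j) \<circ> C'"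
    and "0 < lam1" and "lam1 < 1" and "0 < lam2" and "lam2 < 1"
    and "0 < \<epsilon>" and "\<epsilon> < (1 - lam1) * sqrt A"
    and "\<And>f. let g = op_sqrt H (C \<circ> C') f;
                 x = (\<lambda>j. act L (v j) (\<Lambda> j (proj H (W j) g)));
                 y = (\<lambda>j. act L (u j) (\<Gamma> j (proj H (V j) g)))
             in y \<in> l2_space L J Hs \<and> (\<lambda>j. x j - y j) \<in> l2_space L J Hs \<and>
                l2_norm L J (\<lambda>j. x j - y j) \<le>
                  lam1 * l2_norm L J x + lam2 * l2_norm L J y + \<epsilon> * norm (adj H H K f)"
  shows "controlled_K_g_fusion_frame H L J Hs C C' K V \<Gamma> u"
proof -
  note H = assms(1) and L = assms(3) and K = assms(7) and frame = assms(10) and CC' = assms(14)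
  interpret H: hilbert_module H by fact
  interpret L: hilbert_module L by fact
  have C: "pos_op H C" and C': "pos_op H C'" using assms(8,9) by (auto simp: GL_pos_def)
  define x where "x f j = act L (v j) (\<Lambda> j (proj H (W j) (op_sqrt H (C \<circ> C') f)))" for f j
  define y where "y f j = act L (u j) (\<Gamma> j (proj H (V j) (op_sqrt H (C \<circ> C') f)))" for f j
  define k where "k f = adj H H K f" for f
  define X where "X f = (\<Sum>\<^sub>\<infinity>j\<in>J. ip L (x f j) (x f j))" for f
  define Y where "Y f = (\<Sum>\<^sub>\<infinity>j\<in>J. ip L (y f j) (y f j))" for f
  define tx where "tx f j = (v j)\<^sup>2 * ip L (\<Lambda> j (proj H (W j) (C f))) (\<Lambda> j (proj H (W j) (C' f)))" for f j
  define ty where "ty f j = (u j)\<^sup>2 * ip L (\<Gamma> j (proj H (V j) (C f))) (\<Gamma> j (proj H (V j) (C' f)))" for f j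

  have AB: "0 < A" "A \<le> B" using frame by (auto simp: controlled_frame_bounds_def)
  have tx: "tx f j = ip L (x f j) (x f j)" if "j \<in> J" for f j
    unfolding tx_def x_def
    by (rule controlled_summand [OF H L _ _ _ C C' CC', where S = "Hs j"])
      (use that frame assms(15,16) in \<open>auto simp: controlled_frame_bounds_def\<close>)
  have ty: "ty f j = ip L (y f j) (y f j)" if "j \<in> J" for f j
    unfolding ty_def y_def
    by (rule controlled_summand [OF H L _ _ _ C C' CC', where S = "Hs j"])
      (use that assms(11-13,17,18) in auto)
  have frame_f: "tx f summable_on J \<and> A *\<^sub>R ip H (k f) (k f) \<sqsubseteq> (\<Sum>\<^sub>\<infinity>j\<in>J. tx f j) \<and>
      (\<Sum>\<^sub>\<infinity>j\<in>J. tx f j) \<sqsubseteq> B *\<^sub>R ip H f f" for f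
    using frame by (simp add: controlled_frame_bounds_def Let_def tx_def [abs_def] k_def)
  have X_eq: "(\<Sum>\<^sub>\<infinity>j\<in>J. tx f j) = X f" for f
    unfolding X_def by (rule infsum_cong) (rule tx)
  have x_sum: "(\<lambda>j. ip L (x f j) (x f j)) summable_on J" for f
  proof -
    have "tx f summable_on J \<longleftrightarrow> (\<lambda>j. ip L (x f j) (x f j)) summable_on J"
      by (rule summable_on_cong) (rule tx)
    then show ?thesis using frame_f [of f] by blast
  qed
  have lower: "norm_pos (X f - A *\<^sub>R ip H (k f) (k f))" and upper: "norm_pos (B *\<^sub>R ip H f f - X f)" for f
    using frame_f [of f] by (simp_all add: X_eq cstar_le_def cstar_pos_iff_norm_pos)
  have pert: "y f \<in> l2_space L J Hs" "(\<lambda>j. x f j - y f j) \<in> l2_space L J Hs"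
    "l2_norm L J (\<lambda>j. x f j - y f j) \<le> lam1 * l2_norm L J (x f) + lam2 * l2_norm L J (y f) + \<epsilon> * norm (k f)" for f
    using assms(25) [of f] by (simp_all add: Let_def x_def [abs_def] y_def [abs_def] k_def)
  have y_sum: "(\<lambda>j. ip L (y f j) (y f j)) summable_on J"
    and xy_sum: "(\<lambda>j. ip L (x f j - y f j) (x f j - y f j)) summable_on J" for f
    using pert(1,2) [of f] by (auto simp: l2_space_def)
  have X_pos: "norm_pos (X f)" for f
    unfolding X_def by (rule L.has_sum_ip_norm_pos [OF has_sum_infsum [OF x_sum]])
  have Y_pos: "norm_pos (Y f)" for f
    unfolding Y_def by (rule L.has_sum_ip_norm_pos [OF has_sum_infsum [OF y_sum]])

  have k_le_x: "sqrt A * norm (k f) \<le> l2_norm L J (x f)" for f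
  proof -
    have "norm (A *\<^sub>R ip H (k f) (k f)) \<le> norm (X f)"
      using norm_pos_mono [OF norm_pos_scaleR [OF H.norm_pos_ip [of "k f"], of A] lower [of f]] AB by simp
    then have "sqrt (A * (norm (k f))\<^sup>2) \<le> sqrt (norm (X f))"
      using AB by (simp add: H.norm_ip_self)
    then show ?thesis by (simp add: l2_norm_def X_def real_sqrt_mult)
  qed
  have x_le: "l2_norm L J (x f) \<le> sqrt B * norm f" for f
  proof -
    have "norm (X f) \<le> norm (B *\<^sub>R ip H f f)"
      using norm_pos_mono [OF X_pos [of f] upper [of f]] by simp
    then have "sqrt (norm (X f)) \<le> sqrt (B * (norm f)\<^sup>2)"
      using AB by (simp add: H.norm_ip_self)
    then show ?thesis by (simp add: l2_norm_def X_def real_sqrt_mult)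
  qed
  have x_tri: "l2_norm L J (x f) \<le> l2_norm L J (\<lambda>j. x f j - y f j) + l2_norm L J (y f)" for f
    using L.l2_norm_triangle [OF xy_sum [of f] y_sum [of f]] x_sum [of f] by simp
  have y_tri: "l2_norm L J (y f) \<le> l2_norm L J (\<lambda>j. x f j - y f j) + l2_norm L J (x f)" for f
  proof -
    have "(\<lambda>j. ip L (- (x f j - y f j)) (- (x f j - y f j))) summable_on J"
      using xy_sum [of f] by (simp only: L.ip_minus_left L.ip_minus_right minus_minus)
    from L.l2_norm_triangle [OF this x_sum [of f]] y_sum [of f] show ?thesis
      using L.l2_norm_minus [of J "\<lambda>j. x f j - y f j"] by simp
  qed

  \<comment> \<open>Solving the perturbation inequality for \<open>\<parallel>y f\<parallel>\<close>, with \<open>\<parallel>x f\<parallel> \<ge> \<surd>A \<parallel>K\<^sup>* f\<parallel>\<close> for the lower bound and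
    \<open>\<parallel>K\<^sup>* f\<parallel> \<le> \<surd>(B/A) \<parallel>f\<parallel>\<close> for the upper one.\<close>
  define m where "m = ((1 - lam1) * sqrt A - \<epsilon>) / (1 + lam2)"
  define M where "M = ((1 + lam1) * sqrt B + \<epsilon> * (sqrt B / sqrt A)) / (1 - lam2)"
  have m: "m > 0" using assms(21,24) by (simp add: m_def)
  have "m \<le> sqrt A"
  proof -
    have "(1 - lam1) * sqrt A \<le> (1 + lam2) * sqrt A"
      using AB assms(19,21) by (intro mult_right_mono) auto
    then have "(1 - lam1) * sqrt A - \<epsilon> \<le> (1 + lam2) * sqrt A" using assms(23) by simp
    then show ?thesis using assms(21) by (simp add: m_def field_simps)
  qed
  also have "\<dots> \<le> sqrt B" using AB by simp
  also have "\<dots> \<le> M"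
  proof -
    have "(1 - lam2) * sqrt B \<le> (1 + lam1) * sqrt B"
      using AB assms(19,21) by (intro mult_right_mono) auto
    also have "\<dots> \<le> (1 + lam1) * sqrt B + \<epsilon> * (sqrt B / sqrt A)"
      using AB assms(23) by simp
    finally show ?thesis using assms(22) by (simp add: M_def field_simps)
  qed
  finally have mM: "m \<le> M" .
  have k_le_y: "m * norm (k f) \<le> l2_norm L J (y f)" for f
  proof -
    have "(1 - lam1) * (sqrt A * norm (k f)) \<le> (1 - lam1) * l2_norm L J (x f)"
      using assms(20) by (intro mult_left_mono k_le_x) auto
    also have "\<dots> \<le> (1 + lam2) * l2_norm L J (y f) + \<epsilon> * norm (k f)"
      using x_tri [of f] pert(3) [of f] by (simp add: algebra_simps)
    finally show ?thesis
      using assms(21) by (simp add: m_def field_simps)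
  qed
  have y_le: "l2_norm L J (y f) \<le> M * norm f" for f
  proof -
    have "norm (k f) \<le> (sqrt B / sqrt A) * norm f"
      using order_trans [OF k_le_x x_le, of f] AB by (simp add: field_simps)
    then have k: "\<epsilon> * norm (k f) \<le> \<epsilon> * ((sqrt B / sqrt A) * norm f)"
      using assms(23) by (intro mult_left_mono) auto
    have "(1 - lam2) * l2_norm L J (y f) \<le> (1 + lam1) * l2_norm L J (x f) + \<epsilon> * norm (k f)"
      using y_tri [of f] pert(3) [of f] by (simp add: algebra_simps)
    also have "\<dots> \<le> (1 + lam1) * (sqrt B * norm f) + \<epsilon> * ((sqrt B / sqrt A) * norm f)"
      using assms(19) by (intro add_mono mult_left_mono x_le k) auto
    also have "\<dots> = ((1 + lam1) * sqrt B + \<epsilon> * (sqrt B / sqrt A)) * norm f"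
      by (simp add: distrib_right)
    also have "\<dots> = (1 - lam2) * (M * norm f)"
      using assms(22) by (simp add: M_def)
    finally show ?thesis using assms(22) by simp
  qed

  have k_act: "k (act H a f) = act H a (k f)" for a f
    unfolding k_def
    by (rule H.ip_ext) (simp add: ip_adj [OF H K, symmetric] H.ip_act_right)
  have R_act: "op_sqrt H (C \<circ> C') (act H a f) = act H a (op_sqrt H (C \<circ> C') f)" for a f
    using H.pos_op_op_sqrt [OF H.pos_op_comp [OF C C' CC']] by (simp add: pos_op_def module_linear_def)
  have y_act: "y (act H a f) j = act L a (y f j)" if "j \<in> J" for a f j
    using assms(11-13) [OF that]
    by (simp add: y_def R_act H.proj_act adjointable_def module_linear_def weight_def L.act_act)
  have Y_act: "Y (act H a f) = a * Y f * star a" for a f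
  proof -
    have bl: "bounded_linear (\<lambda>z. a * z * star a)"
      by (rule bounded_linear_compose [OF bounded_linear_mult_left bounded_linear_mult_right])
    have "Y (act H a f) = (\<Sum>\<^sub>\<infinity>j\<in>J. a * ip L (y f j) (y f j) * star a)"
      unfolding Y_def
      by (rule infsum_cong) (simp add: y_act L.ip_act_left L.ip_act_right mult.assoc)
    also have "\<dots> = a * Y f * star a"
      using has_sum_bounded_linear [OF bl has_sum_infsum [OF y_sum [of f]]]
      by (intro infsumI) (simp add: Y_def o_def)
    finally show ?thesis .
  qed
  have Y_norm: "norm (Y f) = (l2_norm L J (y f))\<^sup>2" for f by (simp add: l2_norm_def Y_def)
  have Y_lower: "norm_pos ((1 / m\<^sup>2) *\<^sub>R Y f - ip H (k f) (k f))" for f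
  proof (rule norm_pos_diff_if_conj_norms [OF H.norm_pos_ip Y_pos])
    fix a
    have "m\<^sup>2 * (norm (k (act H a f)))\<^sup>2 \<le> norm (Y (act H a f))"
      unfolding Y_norm power_mult_distrib [symmetric] using m by (intro power_mono k_le_y) auto
    moreover have "(norm (k (act H a f)))\<^sup>2 = norm (a * ip H (k f) (k f) * star a)"
      by (simp add: k_act H.norm_ip_self [symmetric] H.ip_act_left H.ip_act_right mult.assoc)
    ultimately show "norm (a * ip H (k f) (k f) * star a) \<le> 1 / m\<^sup>2 * norm (a * Y f * star a)"
      using m by (simp add: Y_act field_simps)
  qed simp
  have Y_upper: "norm_pos (M\<^sup>2 *\<^sub>R ip H f f - Y f)" for f
  proof (rule norm_pos_diff_if_conj_norms [OF Y_pos H.norm_pos_ip])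
    fix a
    have "norm (Y (act H a f)) \<le> M\<^sup>2 * (norm (act H a f))\<^sup>2"
      unfolding Y_norm power_mult_distrib [symmetric]
      by (intro power_mono y_le) (simp add: l2_norm_def)
    then show "norm (a * Y f * star a) \<le> M\<^sup>2 * norm (a * ip H f f * star a)"
      by (simp add: Y_act H.norm_ip_self [symmetric] H.ip_act_left H.ip_act_right mult.assoc)
  qed simp

  have "controlled_frame_bounds H L J Hs C C' K V \<Gamma> u (m\<^sup>2) (M\<^sup>2)"
    unfolding controlled_frame_bounds_def Let_def
  proof (intro conjI allI ballI)
    show "0 < m\<^sup>2" and "m\<^sup>2 \<le> M\<^sup>2" using m mM by (auto intro: power_mono)
    fix f
    have "ty f summable_on J \<longleftrightarrow> (\<lambda>j. ip L (y f j) (y f j)) summable_on J"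
      by (rule summable_on_cong) (rule ty)
    then have ty_sum: "ty f summable_on J" using y_sum by blast
    have Y_eq: "(\<Sum>\<^sub>\<infinity>j\<in>J. ty f j) = Y f"
      unfolding Y_def by (rule infsum_cong) (rule ty)
    show "(\<lambda>j. (u j)\<^sup>2 * ip L (\<Gamma> j (proj H (V j) (C f))) (\<Gamma> j (proj H (V j) (C' f)))) summable_on J"
      using ty_sum unfolding ty_def [abs_def] .
    have "norm_pos (m\<^sup>2 *\<^sub>R ((1 / m\<^sup>2) *\<^sub>R Y f - ip H (k f) (k f)))"
      by (intro norm_pos_scaleR Y_lower) simp
    then show "m\<^sup>2 *\<^sub>R ip H (adj H H K f) (adj H H K f) \<sqsubseteq>
        (\<Sum>\<^sub>\<infinity>j\<in>J. (u j)\<^sup>2 * ip L (\<Gamma> j (proj H (V j) (C f))) (\<Gamma> j (proj H (V j) (C' f))))"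
      using m Y_eq unfolding ty_def [abs_def]
      by (simp add: cstar_le_def cstar_pos_iff_norm_pos scaleR_diff_right k_def)
    show "(\<Sum>\<^sub>\<infinity>j\<in>J. (u j)\<^sup>2 * ip L (\<Gamma> j (proj H (V j) (C f))) (\<Gamma> j (proj H (V j) (C' f)))) \<sqsubseteq>
        M\<^sup>2 *\<^sub>R ip H f f"
      using Y_eq Y_upper [of f] unfolding ty_def [abs_def]
      by (simp add: cstar_le_def cstar_pos_iff_norm_pos)
  qed (use assms(11-13) in auto)
  then show ?thesis unfolding controlled_K_g_fusion_frame_def by blast
qed

end
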